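(* Let $\tau$ be a finite relational signature in which every relation symbol has arity two, and let $\mathcal{P}_1,\dots,\mathcal{P}_k$ be nonempty hereditary and extendable $\tau$-properties. Suppose that $\mathcal{P}_i$ has one-sided induced-sampling complexity $S_i(\delta)$, and put $S(\delta)=\max_{i\in[k]}S_i(\delta)$. Then $\mathrm{Part}(\mathcal{P}_1,\dots,\mathcal{P}_k)$ has a one-sided induced-sampling tester with sample complexity $$\widetilde O\!\left(\frac{k}{\varepsilon}\,S\!\left(\frac{\varepsilon}{8k}\right)^2\right).$$
   Context: A finite relational signature $\tau$ is a finite list of relation symbols $R$, each with a positive integer arity $a(R)$. A finite $\tau$-structure $\mathcal{A}$ is a finite vertex set $V(\mathcal{A})$ together with relations $R^{\mathcal{A}}\subseteq V(\mathcal{A})^{a(R)}$ for $R\in\tau$. For $U\subseteq V(\mathcal{A})$, the induced substructure $\mathcal{A}[U]$ restricts every relation to tuples with all entries in $U$. A $\tau$-property is a family of finite $\tau$-structures closed under isomorphism; it is hereditary if $\mathcal{A}\in\mathcal{P}$ implies $\mathcal{A}[U]\in\mathcal{P}$ for every $U\subseteq V(\mathcal{A})$; it is extendable if for every $\mathcal{A}\in\mathcal{P}$ and $m\ge0$ there is $\mathcal{B}\in\mathcal{P}$ on $|V(\mathcal{A})|+m$ vertices containing $\mathcal{A}$ as an induced substructure. $\mathrm{Part}(\mathcal{P}_1,\dots,\mathcal{P}_k)$ is the property of admitting a partition $V(\mathcal{A})=V_1\cup\cdots\cup V_k$ (disjoint parts, possibly empty) with $\mathcal{A}[V_i]\in\mathcal{P}_i$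 for every $i$; tuples meeting distinct parts are unrestricted. Distance: for $\tau$-structures on the same $n$-element vertex set, $d_\tau(\mathcal{A},\mathcal{B})=\frac1{|\tau|}\sum_{R\in\tau}\frac{|R^{\mathcal{A}}\triangle R^{\mathcal{B}}|}{n^{a(R)}}$. $\mathcal{A}$ is $\varepsilon$-far from $\mathcal{P}$ if the minimum of $d_\tau(\mathcal{A},\mathcal{B})$ over $\mathcal{B}\in\mathcal{P}$ on the same vertex set exceeds $\varepsilon$. An oblivious induced-sampling tester for $\mathcal{P}$ consists, for every $\varepsilon>0$, of an integer $s(\varepsilon)$ and a collection $\mathcal{R}_\varepsilon$ of isomorphism types of $\tau$-structures on $s(\varepsilon)$ vertices. On input $\mathcal{A}$ with $|V(\mathcal{A})|\ge s(\varepsilon)$ it chooses a uniformly random $S\in\binom{V(\mathcal{A})}{s(\varepsilon)}$, reveals $\mathcal{A}[S]$, and rejects iff $\mathcal{A}[S]\in\mathcal{R}_\varepsilon$; if $|V(\mathcal{A})|<s(\varepsilon)$ it may inspect the whole input and decide membership exactly. It has one-sided error if it always accepts members of $\mathcal{P}$; it is sound if it rejects every $\varepsilon$-far input with probability at least $2/3$. A one-sided induced-sampling tester is a sound one with one-sided error; its sample complexity is $s(\varepsilon)$, and "one-sided induced-sampling complexity $S_i$" means that such a tester with sample complexity $S_i$ exists. Complexity bounds are tacitly taken nonincreasing in the proximity parameter. $\widetilde O(\cdot)$ hides polylogarithmic factors in the displayed quantities. *)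

theory Defs
  imports "HOL-Probability.Probability"
begin

text \<open>
  A signature is the list of the arities of its relation symbols; the symbols themselves are the
  positions in this list. A structure carries the list of its relations in the same order, and a
  tuple is a list of vertices.
\<close>

type_synonym signature = "nat list"

record 'v rstruct =
  verts :: "'v set"
  rels :: "'v list set list"

definition finite_structure :: "signature \<Rightarrow> 'v rstruct \<Rightarrow> bool" where
  "finite_structure \<tau> A \<longleftrightarrow>
     finite (verts A) \<and> length (rels A) = length \<tau> \<and>
     (\<forall>r<length \<tau>. rels A ! r \<subseteq> {t. length t = \<tau> ! r \<and> set t \<subseteq> verts A})"

text \<open>Only used for \<open>U \<subseteq> verts A\<close>.\<close>

definition induced :: "'v rstruct \<Rightarrow> 'v set \<Rightarrow> 'v rstruct" where
  "induced A U = \<lparr>verts = U, rels = map (\<lambda>R. {t \<in> R. set t \<subseteq> U}) (rels A)\<rparr>"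

definition isomorphic :: "'v rstruct \<Rightarrow> 'w rstruct \<Rightarrow> bool" where
  "isomorphic A B \<longleftrightarrow>
     (\<exists>f. bij_betw f (verts A) (verts B) \<and> rels B = map (\<lambda>R. map f ` R) (rels A))"

text \<open>
  Finite structures are taken with vertices in \<^typ>\<open>nat\<close>, which represents every isomorphism
  type. An isomorphism-closed set of such structures also serves as a collection of
  isomorphism types.
\<close>

type_synonym family = "nat rstruct set"

definition is_property :: "signature \<Rightarrow> family \<Rightarrow> bool" where
  "is_property \<tau> P \<longleftrightarrow>
     (\<forall>A\<in>P. finite_structure \<tau> A) \<and>
     (\<forall>A\<in>P. \<forall>B. finite_structure \<tau> B \<and> isomorphic A B \<longrightarrow> B \<in> P)"

definition hereditary :: "family \<Rightarrow> bool" where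
  "hereditary P \<longleftrightarrow> (\<forall>A\<in>P. \<forall>U\<subseteq>verts A. induced A U \<in> P)"

definition extendable :: "family \<Rightarrow> bool" where
  "extendable P \<longleftrightarrow>
     (\<forall>A\<in>P. \<forall>m. \<exists>B\<in>P. card (verts B) = card (verts A) + m \<and>
        verts A \<subseteq> verts B \<and> induced B (verts A) = A)"

definition Part :: "signature \<Rightarrow> nat \<Rightarrow> (nat \<Rightarrow> family) \<Rightarrow> family" where
  "Part \<tau> k P = {A. finite_structure \<tau> A \<and>
     (\<exists>V. (\<Union>i\<in>{1..k}. V i) = verts A \<and> disjoint_family_on V {1..k} \<and>
          (\<forall>i\<in>{1..k}. induced A (V i) \<in> P i))}"

text \<open>
  For structures on the same vertex set. Division by zero makes the distance \<open>0\<close> for the empty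
  signature and, with positive arities, for the empty vertex set.
\<close>

definition struct_dist :: "signature \<Rightarrow> 'v rstruct \<Rightarrow> 'v rstruct \<Rightarrow> real" where
  "struct_dist \<tau> A B =
     1 / real (length \<tau>) *
     (\<Sum>r<length \<tau>. real (card (sym_diff (rels A ! r) (rels B ! r))) /
                     real (card (verts A)) ^ (\<tau> ! r))"

text \<open>
  Only finitely many \<open>B\<close> share the vertex set of \<open>A\<close>, so the minimum distance exceeds \<open>\<epsilon>\<close> iff
  each distance does; the minimum over no \<open>B\<close> at all is read as infinite.
\<close>

definition far :: "signature \<Rightarrow> family \<Rightarrow> real \<Rightarrow> nat rstruct \<Rightarrow> bool" where
  "far \<tau> P \<epsilon> A \<longleftrightarrow> (\<forall>B\<in>P. verts B = verts A \<longrightarrow> struct_dist \<tau> A B > \<epsilon>)"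

text \<open>
  The distribution of the verdict (\<^const>\<open>True\<close> means accept) on input \<open>A\<close> of the tester for \<open>P\<close>
  with sample size \<open>s\<close> and rejected types \<open>R\<close>.
\<close>

definition verdict :: "family \<Rightarrow> nat \<Rightarrow> family \<Rightarrow> nat rstruct \<Rightarrow> bool pmf" where
  "verdict P s R A =
     (if card (verts A) < s then return_pmf (A \<in> P)
      else map_pmf (\<lambda>S. induced A S \<notin> R) (pmf_of_set {S. S \<subseteq> verts A \<and> card S = s}))"

definition one_sided_tester ::
    "signature \<Rightarrow> family \<Rightarrow> (real \<Rightarrow> nat) \<Rightarrow> (real \<Rightarrow> family) \<Rightarrow> bool" where
  "one_sided_tester \<tau> P s R \<longleftrightarrow> (\<forall>\<epsilon>>0.
     is_property \<tau> (R \<epsilon>) \<and> (\<forall>A\<in>R \<epsilon>. card (verts A) = s \<epsilon>) \<and>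
     (\<forall>A\<in>P. pmf (verdict P (s \<epsilon>) (R \<epsilon>) A) True = 1) \<and>
     (\<forall>A. finite_structure \<tau> A \<and> far \<tau> P \<epsilon> A \<longrightarrow>
        pmf (verdict P (s \<epsilon>) (R \<epsilon>) A) False \<ge> 2 / 3))"

text \<open>Complexity bounds are nonincreasing in the proximity parameter by convention.\<close>

definition one_sided_complexity :: "signature \<Rightarrow> family \<Rightarrow> (real \<Rightarrow> nat) \<Rightarrow> bool" where
  "one_sided_complexity \<tau> P s \<longleftrightarrow> antimono_on {0<..} s \<and> (\<exists>R. one_sided_tester \<tau> P s R)"

end

theory Submission
  imports Defs
begin

text \<open>
  The tester draws a sample and rejects it iff the sample itself lies outside the partition
  property. Heredity passes from the parts to the partition property, so members are never
  rejected. Soundness is a union bound over containers.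

  Fix an input \<open>A\<close> on \<open>n\<close> vertices, write \<open>\<delta> = \<epsilon> / (8 k)\<close>, and consider one of the properties
  \<open>P\<close>, with a tester that draws \<open>m \<le> S\<close> vertices at proximity \<open>\<delta>\<close>. The \<open>m\<close>-sets of vertices that
  this tester rejects form a hypergraph. A set \<open>I\<close> that induces a member of \<open>P\<close> contains no
  edge, because the tester is one-sided; a set of at least \<open>m\<close> vertices that induces a structure
  \<open>\<delta>\<close>-far from \<open>P\<close> contains at least two thirds of its \<open>m\<close>-subsets as edges, because the tester
  is sound. Where edges are that plentiful, revealing at most \<open>S\<close> vertices of an independent set \<open>I\<close> exhibits a
  \<open>1 / (4 S)\<close> fraction of the vertices that \<open>I\<close> must avoid (\<open>shrink_once\<close>).
  Put \<open>L = log 2 (2 + k / \<epsilon> + S)\<close>.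
  Repeating this \<open>O(S L)\<close> times confines \<open>I\<close> to a container that depends only on a fingerprint of at
  most \<open>q = O(S\<^sup>2 L)\<close> vertices of \<open>I\<close>, and the container either has at most \<open>\<delta> n\<close> vertices
  or induces a structure that is not \<open>\<delta>\<close>-far from \<open>P\<close> (\<open>property_containers\<close>).

  Take one container for each of the \<open>k\<close> properties. If they covered all but \<open>\<epsilon> n / 8\<close> vertices,
  \<open>A\<close> could be edited into the partition property (\<open>uncovered_large\<close>): drop the containers
  that are merely small, replace \<open>A\<close> on each other container by a nearby member of its property,
  make these containers disjoint by heredity, and add the at most \<open>\<epsilon> n / 4\<close> remaining vertices to the
  first part by extendability. The replacements cost at most \<open>k \<delta> = \<epsilon> / 8\<close> and, since the arity is two, the remaining vertices at most
  \<open>2 (\<epsilon> / 4)\<close>. Hence for an \<open>\<epsilon>\<close>-far \<open>A\<close> every choice of \<open>k\<close> fingerprints leaves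
  more than \<open>\<epsilon> n / 8\<close> vertices uncovered.

  A sample of \<open>s\<close> vertices that lies in the partition property contains \<open>k\<close> fingerprints and is
  covered by their containers. Inside the sample there are at most \<open>(s + 1)^(k q)\<close> choices of
  fingerprints, and for each of them the at least \<open>s - k q\<close> other vertices are all covered with
  probability at most \<open>(1 - \<epsilon> / 8)^(s - k q)\<close> (\<open>card_covered_sets\<close>). A sample size \<open>s\<close> of order
  \<open>k q / \<epsilon>\<close>, up to logarithmic factors, makes the product at most one third.
\<close>

section \<open>Counting subsets\<close>

text \<open>
  Each factor of \<open>y (y - 1) \<dots>\<close> is at most \<open>x\<close> times the corresponding factor of
  \<open>n (n - 1) \<dots>\<close>, since decreasing both by one only helps when \<open>x \<le> 1\<close>.
\<close>

lemma binomial_scaled_le: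
  fixes x :: real
  assumes "0 \<le> x" "x \<le> 1" "real y \<le> x * real n"
  shows "real (y choose m) \<le> x ^ m * real (n choose m)"
  using assms(3)
proof (induction m arbitrary: y n)
  case 0
  then show ?case by simp
next
  case (Suc m)
  show ?case
  proof (cases y)
    case 0
    then show ?thesis using assms(1) by simp
  next
    case (Suc y')
    with Suc.prems obtain n' where n: "n = Suc n'" by (cases n) auto
    have "real y' \<le> x * real n'"
      using Suc.prems assms(2) unfolding Suc n by (simp add: algebra_simps)
    then have IH: "real (y' choose m) \<le> x ^ m * real (n' choose m)" by (rule Suc.IH)
    have "real (Suc m) * real (y choose Suc m) = real y * real (y' choose m)"
      unfolding Suc by (metis Suc_times_binomial of_nat_mult)
    also have "\<dots> \<le> (x * real n) * (x ^ m * real (n' choose m))"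
      by (intro mult_mono IH Suc.prems) (use assms(1) in auto)
    also have "\<dots> = x ^ Suc m * (real n * real (n' choose m))" by simp
    also have "real n * real (n' choose m) = real (Suc m) * real (n choose Suc m)"
      unfolding n by (metis Suc_times_binomial of_nat_mult)
    finally have "real (Suc m) * real (y choose Suc m)
        \<le> real (Suc m) * (x ^ Suc m * real (n choose Suc m))" by (simp only: mult_ac)
    then show ?thesis by (rule mult_left_le_imp_le) simp
  qed
qed

lemma card_sets_between:
  assumes "finite Y" "G \<subseteq> Y" "card G \<le> s"
  shows "card {T. G \<subseteq> T \<and> T \<subseteq> Y \<and> card T = s} = (card Y - card G) choose (s - card G)"
proof -
  have fG: "finite G" using assms by (rule_tac finite_subset)
  have "bij_betw (\<lambda>B. B \<union> G) {B. B \<subseteq> Y - G \<and> card B = s - card G}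
          {T. G \<subseteq> T \<and> T \<subseteq> Y \<and> card T = s}"
  proof (rule bij_betw_byWitness[where f' = "\<lambda>T. T - G"])
    show "(\<lambda>B. B \<union> G) ` {B. B \<subseteq> Y - G \<and> card B = s - card G}
        \<subseteq> {T. G \<subseteq> T \<and> T \<subseteq> Y \<and> card T = s}"
    proof (clarify)
      fix B assume B: "B \<subseteq> Y - G" "card B = s - card G"
      have "card (B \<union> G) = card B + card G"
        by (rule card_Un_disjoint) (use B fG assms in \<open>auto intro: finite_subset\<close>)
      then show "G \<subseteq> B \<union> G \<and> B \<union> G \<subseteq> Y \<and> card (B \<union> G) = s"
        using B assms by auto
    qed
    show "(\<lambda>T. T - G) ` {T. G \<subseteq> T \<and> T \<subseteq> Y \<and> card T = s}
        \<subseteq> {B. B \<subseteq> Y - G \<and> card B = s - card G}"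
      using fG by (auto simp: card_Diff_subset)
  qed auto
  then have "card {T. G \<subseteq> T \<and> T \<subseteq> Y \<and> card T = s}
      = card {B. B \<subseteq> Y - G \<and> card B = s - card G}"
    by (rule bij_betw_same_card[symmetric])
  also have "\<dots> = card (Y - G) choose (s - card G)"
    using assms by (intro n_subsets) auto
  finally show ?thesis using fG assms by (simp add: card_Diff_subset)
qed

lemma card_small_subsets:
  assumes "finite T"
  shows "card {F. F \<subseteq> T \<and> card F \<le> q} \<le> (card T + 1) ^ q"
proof (induction q)
  case 0
  have "{F. F \<subseteq> T \<and> card F \<le> 0} = {{}}" using assms by (auto dest: finite_subset)
  then show ?case by simp
next
  case (Suc q)
  let ?N = "{F. F \<subseteq> T \<and> card F \<le> q}" and ?O = "insert None (Some ` T)"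
  let ?g = "\<lambda>(F, x). case x of None \<Rightarrow> F | Some a \<Rightarrow> insert a F"
  have fin: "finite (?N \<times> ?O)" using assms by auto
  have "{F. F \<subseteq> T \<and> card F \<le> Suc q} \<subseteq> ?g ` (?N \<times> ?O)"
  proof clarify
    fix F assume F: "F \<subseteq> T" "card F \<le> Suc q"
    show "F \<in> ?g ` (?N \<times> ?O)"
    proof (cases "card F \<le> q")
      case True
      with F have "F = ?g (F, None)" "(F, None) \<in> ?N \<times> ?O" by auto
      then show ?thesis by (rule image_eqI)
    next
      case False
      then obtain a where a: "a \<in> F" by (metis card.empty ex_in_conv le0)
      have "finite F" using F assms by (auto dest: finite_subset)
      then have "F = ?g (F - {a}, Some a)" "(F - {a}, Some a) \<in> ?N \<times> ?O"
        using F a by auto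
      then show ?thesis by (rule image_eqI)
    qed
  qed
  then have "card {F. F \<subseteq> T \<and> card F \<le> Suc q} \<le> card (?N \<times> ?O)"
    using surj_card_le[OF fin] by blast
  also have "\<dots> = card ?N * (card T + 1)"
    using assms by (simp add: card_cartesian_product card_image)
  also have "\<dots> \<le> (card T + 1) ^ q * (card T + 1)"
    using Suc.IH by (rule mult_right_mono) simp
  finally show ?case by (simp add: mult.commute)
qed

section \<open>Fingerprints and containers of independent sets\<close>

text \<open>
  Here \<open>g\<close> computes something from a set, such as a container. Its value at \<open>I\<close> can be recovered from
  the fingerprint \<open>fp I\<close> alone; asking this for every set between \<open>fp I\<close> and \<open>I\<close>
  allows two stages to be composed by taking the union of their fingerprints.
\<close>

definition fingerprints :: "'a set set \<Rightarrow> nat \<Rightarrow> ('a set \<Rightarrow> 'a set) \<Rightarrow> ('a set \<Rightarrow> 'b) \<Rightarrow> bool" where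
  "fingerprints \<I> q fp g \<longleftrightarrow> (\<forall>I\<in>\<I>. fp I \<subseteq> I \<and> finite (fp I) \<and> card (fp I) \<le> q \<and>
     (\<forall>J. fp I \<subseteq> J \<and> J \<subseteq> I \<longrightarrow> g J = g I))"

lemma fingerprintsD:
  assumes "fingerprints \<I> q fp g" "I \<in> \<I>"
  shows "fp I \<subseteq> I" "finite (fp I)" "card (fp I) \<le> q"
    "fp I \<subseteq> J \<Longrightarrow> J \<subseteq> I \<Longrightarrow> g J = g I"
  using assms unfolding fingerprints_def by blast+

definition independent_sets :: "'a set set \<Rightarrow> 'a set set" where
  "independent_sets H = {I. \<forall>e\<in>H. \<not> e \<subseteq> I}"

lemma sum_card_links:
  assumes "finite U" "E \<subseteq> {e. e \<subseteq> U \<and> card e = m}"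
  shows "(\<Sum>v\<in>U. card {e\<in>E. v \<in> e}) = m * card E"
proof -
  have fE: "finite E" by (rule finite_subset[of _ "Pow U"]) (use assms in auto)
  have "(\<Sum>v\<in>U. card {e\<in>E. v \<in> e}) = (\<Sum>v\<in>U. \<Sum>e\<in>E. if v \<in> e then 1 else 0)"
    using fE by (simp add: sum.If_cases Int_def)
  also have "\<dots> = (\<Sum>e\<in>E. \<Sum>v\<in>U. if v \<in> e then 1 else 0)" by (rule sum.swap)
  also have "\<dots> = (\<Sum>e\<in>E. m)"
  proof (rule sum.cong[OF refl])
    fix e assume "e \<in> E"
    then have "e \<subseteq> U" "card e = m" using assms by auto
    moreover from this have "U \<inter> e = e" by auto
    ultimately show "(\<Sum>v\<in>U. if v \<in> e then 1 else 0) = m"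
      using assms(1) by (simp add: sum.If_cases)
  qed
  finally show ?thesis by simp
qed

text \<open>
  The link of \<open>v\<close> consists of the sets \<open>e - {v}\<close> for the edges \<open>e\<close> through \<open>v\<close>. Link densities
  average to the edge density, and none exceeds one, so a loss of \<open>\<eta>\<close> in density leaves an
  \<open>\<eta>\<close> fraction of the vertices.
\<close>

lemma many_dense_links:
  fixes b \<eta> :: real
  assumes "finite U" "E \<subseteq> {e. e \<subseteq> U \<and> card e = Suc m}"
    and "(b + \<eta>) * real (card U choose Suc m) \<le> real (card E)" and "0 \<le> b" "\<eta> \<le> 1"
  shows "\<eta> * real (card U)
    \<le> real (card {v\<in>U. b * real ((card U - 1) choose m) \<le> real (card {e\<in>E. v \<in> e})})"
    (is "_ \<le> real (card ?X)")
proof (cases "card U \<le> m")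
  case True
  have "?X = U"
  proof (cases "U = {}")
    case False
    then have "card U - 1 < m" using True assms(1) by (cases "card U") auto
    then show ?thesis by (auto simp: binomial_eq_0)
  qed auto
  then show ?thesis using mult_right_mono[of \<eta> 1 "real (card U)"] assms(5) by simp
next
  case False
  then obtain w where w: "card U = Suc w" "m \<le> w" by (cases "card U") auto
  define N where "N = real (w choose m)"
  have N: "N > 0" using w by (simp add: N_def)
  have fX: "finite ?X" using assms(1) by simp
  have bound: "real (card {e\<in>E. v \<in> e}) \<le> N" if "v \<in> U" for v
  proof -
    have "card {e\<in>E. v \<in> e} \<le> card {e. {v} \<subseteq> e \<and> e \<subseteq> U \<and> card e = Suc m}"
      using assms by (intro card_mono) auto
    also have "\<dots> = w choose m"
      using card_sets_between[of U "{v}" "Suc m"] that assms(1) w by simp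
    finally show ?thesis by (simp add: N_def)
  qed
  have "(b + \<eta>) * real (card U) * N = (b + \<eta>) * (real (Suc m) * real (card U choose Suc m))"
    unfolding w N_def by (metis Suc_times_binomial of_nat_mult mult.assoc)
  also have "\<dots> = real (Suc m) * ((b + \<eta>) * real (card U choose Suc m))"
    by simp
  also have "\<dots> \<le> real (Suc m) * real (card E)"
    by (intro mult_left_mono assms(3)) simp
  also have "\<dots> = (\<Sum>v\<in>U. real (card {e\<in>E. v \<in> e}))"
    using sum_card_links[OF assms(1,2)] by (metis of_nat_mult of_nat_sum)
  also have "\<dots> = (\<Sum>v\<in>?X. real (card {e\<in>E. v \<in> e})) + (\<Sum>v\<in>U-?X. real (card {e\<in>E. v \<in> e}))"
    using assms(1) by (subst sum.subset_diff[of ?X U]) auto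
  also have "\<dots> \<le> (\<Sum>v\<in>?X. N) + (\<Sum>v\<in>U-?X. b * N)"
    using bound by (intro add_mono sum_mono) (auto simp: N_def w)
  also have "\<dots> \<le> (\<Sum>v\<in>?X. N) + (\<Sum>v\<in>U. b * N)"
    using assms(1,4) N by (intro add_left_mono sum_mono2) auto
  also have "\<dots> = (real (card ?X) + b * real (card U)) * N" by (simp add: algebra_simps)
  finally have "(b + \<eta>) * real (card U) \<le> real (card ?X) + b * real (card U)"
    using N by simp
  then show ?thesis by (simp add: algebra_simps)
qed

text \<open>
  The container step. Let \<open>X\<close> be the set of vertices whose link is almost as dense as \<open>E\<close>. If an
  independent set \<open>I\<close> misses \<open>X\<close>, then \<open>X\<close> is a large set avoided by \<open>I\<close>. Otherwise the least
  vertex of \<open>I \<inter> X\<close> goes into the fingerprint and the argument continues in its link, where \<open>I\<close>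
  is still independent. Uniformity zero is never reached, because there positive density makes
  the empty set an edge. Each of the \<open>m\<close> levels may lose \<open>\<eta>\<close> in density, which is why \<open>a + m \<eta>\<close> is
  required at the start. Any \<open>J\<close> between the fingerprint and \<open>I\<close> passes through the same choices,
  since the least element of \<open>I \<inter> X\<close> is also the least element of \<open>J \<inter> X\<close>.
\<close>

lemma avoided_vertices_from_fingerprint:
  fixes a \<eta> :: real
  assumes "finite (U::'a::linorder set)" "E \<subseteq> {e. e \<subseteq> U \<and> card e = m}" "0 < a" "0 \<le> \<eta>" "\<eta> \<le> 1"
    and "(a + real m * \<eta>) * real (card U choose m) \<le> real (card E)"
  shows "\<exists>fp D. fingerprints (independent_sets E) m fp D \<and>
           (\<forall>I\<in>independent_sets E. I \<inter> D I = {}) \<and>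
           (\<forall>J. D J \<subseteq> U \<and> \<eta> * (real (card U) - real m) \<le> real (card (D J)))"
  using assms(1,2,6)
proof (induction m arbitrary: U E)
  case 0
  have "card E > 0"
    using 0 assms(3) by simp
  then obtain e where "e \<in> E" by (auto simp: card_gt_0_iff)
  moreover have "e = {}" if "e \<in> E" for e
    using that "0.prems"(1,2) finite_subset[of e U] by auto
  ultimately have "{} \<in> E" by auto
  then have "independent_sets E = {}" by (auto simp: independent_sets_def)
  moreover have "\<eta> * real (card U) \<le> real (card U)"
    using mult_right_mono[of \<eta> 1 "real (card U)"] assms(5) by simp
  ultimately show ?case
    by (intro exI[of _ "\<lambda>_. {}"] exI[of _ "\<lambda>_. U"]) (simp add: fingerprints_def)
next
  case (Suc m)
  define E' where "E' v = (\<lambda>e. e - {v}) ` {e\<in>E. v \<in> e}" for v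
  define X where "X = {v\<in>U. (a + real m * \<eta>) * real ((card U - 1) choose m)
     \<le> real (card {e\<in>E. v \<in> e})}"
  have X: "X \<subseteq> U" "finite X" using Suc.prems(1) by (auto simp: X_def)
  have E'_card: "card (E' v) = card {e\<in>E. v \<in> e}" for v
    unfolding E'_def by (rule card_image) (auto intro!: inj_onI)
  have large: "\<eta> * real (card U) \<le> real (card X)"
    unfolding X_def
  proof (rule many_dense_links[OF Suc.prems(1,2)])
    show "(a + real m * \<eta> + \<eta>) * real (card U choose Suc m) \<le> real (card E)"
      using Suc.prems(3) by (simp add: algebra_simps)
  qed (use assms(3-5) in auto)
  have "\<forall>v\<in>X. \<exists>fp D. fingerprints (independent_sets (E' v)) m fp D \<and>
           (\<forall>I\<in>independent_sets (E' v). I \<inter> D I = {}) \<and>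
           (\<forall>J. D J \<subseteq> U - {v} \<and>
             \<eta> * (real (card (U - {v})) - real m) \<le> real (card (D J)))"
  proof
    fix v assume v: "v \<in> X"
    show "\<exists>fp D. fingerprints (independent_sets (E' v)) m fp D \<and>
           (\<forall>I\<in>independent_sets (E' v). I \<inter> D I = {}) \<and>
           (\<forall>J. D J \<subseteq> U - {v} \<and>
             \<eta> * (real (card (U - {v})) - real m) \<le> real (card (D J)))"
    proof (rule Suc.IH)
      show "E' v \<subseteq> {e. e \<subseteq> U - {v} \<and> card e = m}"
        using Suc.prems(2) by (auto simp: E'_def)
      show "(a + real m * \<eta>) * real (card (U - {v}) choose m) \<le> real (card (E' v))"
        using v Suc.prems(1) by (simp add: E'_card X_def)
    qed (use v Suc.prems X in auto)
  qed
  then obtain fp D where FD: "\<forall>v\<in>X. fingerprints (independent_sets (E' v)) m (fp v) (D v) \<and>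
           (\<forall>I\<in>independent_sets (E' v). I \<inter> D v I = {}) \<and>
           (\<forall>J. D v J \<subseteq> U - {v} \<and>
             \<eta> * (real (card (U - {v})) - real m) \<le> real (card (D v J)))"
    unfolding bchoice_iff by (elim exE) (rule that)
  note FD' = FD[THEN bspec]
  note fp = FD'[THEN conjunct1]
    and disj = FD'[THEN conjunct2, THEN conjunct1, THEN bspec]
    and D = FD'[THEN conjunct2, THEN conjunct2, THEN spec, THEN conjunct1]
      FD'[THEN conjunct2, THEN conjunct2, THEN spec, THEN conjunct2]
  define fp' where "fp' I = (if I \<inter> X = {} then {} else insert (Min (I \<inter> X)) (fp (Min (I \<inter> X)) I))" for I
  define D' where "D' J = (if J \<inter> X = {} then X else D (Min (J \<inter> X)) J)" for J
  have Min_X: "Min (I \<inter> X) \<in> X" "Min (I \<inter> X) \<in> I" if "I \<inter> X \<noteq> {}" for I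
    using Min_in[of "I \<inter> X"] that X by auto
  have link: "I \<in> independent_sets (E' v)" if "I \<in> independent_sets E" "v \<in> I" for I v
  proof -
    have "e \<subseteq> I" if "e - {v} \<subseteq> I" for e using that \<open>v \<in> I\<close> by auto
    then show ?thesis using that(1) by (auto simp: independent_sets_def E'_def)
  qed
  have "fingerprints (independent_sets E) (Suc m) fp' D'"
    unfolding fingerprints_def
  proof (intro ballI)
    fix I assume I: "I \<in> independent_sets E"
    show "fp' I \<subseteq> I \<and> finite (fp' I) \<and> card (fp' I) \<le> Suc m \<and> (\<forall>J. fp' I \<subseteq> J \<and> J \<subseteq> I \<longrightarrow> D' J = D' I)"
    proof (cases "I \<inter> X = {}")
      case True
      then have "J \<inter> X = {}" if "J \<subseteq> I" for J using that by auto
      then show ?thesis using True by (auto simp: fp'_def D'_def)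
    next
      case False
      define v where "v = Min (I \<inter> X)"
      have v: "v \<in> X" "v \<in> I" using Min_X[OF False] by (auto simp: v_def)
      note F = fingerprintsD[OF fp[OF v(1)] link[OF I v(2)]]
      have fpI: "fp' I = insert v (fp v I)" using False by (simp add: fp'_def v_def)
      have "D' J = D' I" if J: "fp' I \<subseteq> J" "J \<subseteq> I" for J
      proof -
        have vJ: "v \<in> J \<inter> X" using J v fpI by auto
        have "Min (J \<inter> X) = v"
        proof (rule Min_eqI)
          fix y assume "y \<in> J \<inter> X"
          then have "y \<in> I \<inter> X" using J by auto
          then show "v \<le> y" unfolding v_def using X by (intro Min_le) auto
        qed (use X vJ in auto)
        then have "D' J = D v J" using vJ by (auto simp: D'_def)
        also have "\<dots> = D v I" using J fpI by (intro F(4)) auto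
        also have "\<dots> = D' I" using False by (simp add: D'_def v_def)
        finally show ?thesis .
      qed
      moreover have "card (insert v (fp v I)) \<le> Suc m"
        using F(2,3) by (simp add: card_insert_if)
      moreover have "fp' I \<subseteq> I" "finite (fp' I)" using F(1,2) v by (simp_all add: fpI)
      ultimately show ?thesis unfolding fpI by blast
    qed
  qed
  moreover have "I \<inter> D' I = {}" if I: "I \<in> independent_sets E" for I
  proof (cases "I \<inter> X = {}")
    case False
    then show ?thesis using disj[OF Min_X(1)[OF False] link[OF I Min_X(2)[OF False]]]
      by (simp add: D'_def)
  qed (simp add: D'_def)
  moreover have "D' J \<subseteq> U \<and> \<eta> * (real (card U) - real (Suc m)) \<le> real (card (D' J))" for J
  proof (cases "J \<inter> X = {}")
    case True
    have "\<eta> * (real (card U) - real (Suc m)) \<le> \<eta> * real (card U)"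
      using assms(4) by (intro mult_left_mono) auto
    then show ?thesis using True X large by (simp add: D'_def)
  next
    case False
    define v where "v = Min (J \<inter> X)"
    have v: "v \<in> X" using Min_X[OF False] by (simp add: v_def)
    have "v \<in> U" using v X by auto
    then have "card U > 0" using Suc.prems(1) by (auto simp: card_gt_0_iff)
    then have "real (card (U - {v})) - real m = real (card U) - real (Suc m)"
      using \<open>v \<in> U\<close> Suc.prems(1) by (simp add: of_nat_diff)
    moreover have "D' J = D v J" using False by (simp add: D'_def v_def)
    ultimately show ?thesis using D[OF v, of J] by (auto simp: diff_diff_eq)
  qed
  ultimately show ?case by blast
qed

definition two_thirds_full :: "'a set set \<Rightarrow> nat \<Rightarrow> 'a set \<Rightarrow> bool" where
  "two_thirds_full H m W \<longleftrightarrow> 2 / 3 * real (card W choose m) \<le> real (card {e\<in>H. e \<subseteq> W})"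

text \<open>
  With \<open>\<eta> = 1 / (2 S)\<close> the at most \<open>S\<close> levels lose at most \<open>1 / 2\<close> of the density \<open>2 / 3\<close>. The bound
  \<open>2 S \<le> card W\<close> guarantees that at least half of \<open>W\<close> is left after removing the fingerprint, so
  the avoided set has at least \<open>card W / (4 S)\<close> elements.
\<close>

lemma shrink_once:
  fixes W :: "'a::linorder set"
  assumes "finite W" "\<forall>e\<in>H. card e = m" "m \<le> S" "1 \<le> S" "2 * S \<le> card W" "two_thirds_full H m W"
  shows "\<exists>fp c. fingerprints (independent_sets H \<inter> Pow W) S fp c \<and>
           (\<forall>I\<in>independent_sets H \<inter> Pow W. I \<subseteq> c I) \<and>
           (\<forall>J. c J \<subseteq> W \<and> real (card (c J)) \<le> (1 - 1 / (4 * real S)) * real (card W))"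
proof -
  define E where "E = {e\<in>H. e \<subseteq> W}"
  define \<eta> where "\<eta> = 1 / (2 * real S)"
  have \<eta>: "0 \<le> \<eta>" "\<eta> \<le> 1" "real m * \<eta> \<le> 1 / 2"
    using assms(3,4) by (auto simp: \<eta>_def field_simps)
  have "(1 / 6 + real m * \<eta>) * real (card W choose m) \<le> 2 / 3 * real (card W choose m)"
    using \<eta> by (intro mult_right_mono) auto
  also have "\<dots> \<le> real (card E)" using assms(6) by (simp add: two_thirds_full_def E_def)
  finally have dens: "(1 / 6 + real m * \<eta>) * real (card W choose m) \<le> real (card E)" .
  have loss_left: "(0::real) < 1 / 6" by simp
  have "E \<subseteq> {e. e \<subseteq> W \<and> card e = m}" using assms(2) by (auto simp: E_def)
  from avoided_vertices_from_fingerprint[OF assms(1) this loss_left \<eta>(1,2) dens] obtain fp D where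
    fp: "fingerprints (independent_sets E) m fp D" and
    disj: "\<And>I. I \<in> independent_sets E \<Longrightarrow> I \<inter> D I = {}" and
    D: "\<And>J. D J \<subseteq> W" "\<And>J. \<eta> * (real (card W) - real m) \<le> real (card (D J))"
    by (auto simp only:)
  have sub: "independent_sets H \<subseteq> independent_sets E" by (auto simp: independent_sets_def E_def)
  have "fingerprints (independent_sets H \<inter> Pow W) S fp (\<lambda>J. W - D J)"
    unfolding fingerprints_def
  proof (intro ballI)
    fix I assume "I \<in> independent_sets H \<inter> Pow W"
    then have "I \<in> independent_sets E" using sub by auto
    note F = fingerprintsD[OF fp this]
    have "\<forall>J. fp I \<subseteq> J \<and> J \<subseteq> I \<longrightarrow> W - D J = W - D I" using F(4) by simp
    then show "fp I \<subseteq> I \<and> finite (fp I) \<and> card (fp I) \<le> S \<and>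
        (\<forall>J. fp I \<subseteq> J \<and> J \<subseteq> I \<longrightarrow> W - D J = W - D I)"
      using F(1-3) assms(3) by (meson le_trans)
  qed
  moreover have "\<forall>I\<in>independent_sets H \<inter> Pow W. I \<subseteq> W - D I" using disj sub by blast
  moreover have "real (card (W - D J)) \<le> (1 - 1 / (4 * real S)) * real (card W)" for J
  proof -
    have "1 / (4 * real S) * real (card W) = \<eta> * (real (card W) / 2)" by (simp add: \<eta>_def)
    also have "\<dots> \<le> \<eta> * (real (card W) - real m)"
      using assms(3,5) \<eta> by (intro mult_left_mono) auto
    also have "\<dots> \<le> real (card (D J))" by (rule D)
    finally have "1 / (4 * real S) * real (card W) \<le> real (card (D J))" .
    moreover have "real (card (W - D J)) = real (card W) - real (card (D J))"
      using D(1)[of J] assms(1) by (simp add: card_Diff_subset finite_subset card_mono of_nat_diff)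
    ultimately show ?thesis by (simp add: algebra_simps)
  qed
  ultimately show ?thesis by (intro exI[of _ fp] exI[of _ "\<lambda>J. W - D J"]) auto
qed

text \<open>
  Shrinking is iterated for \<open>r\<close> rounds, or until a set is reached on which it is not applicable.
  The later rounds depend on the set left by the first one, which the fingerprint of the first
  round determines.
\<close>

lemma containers_exist:
  fixes W :: "'a::linorder set"
  assumes "finite W" "\<forall>e\<in>H. card e = m" "m \<le> S" "1 \<le> S"
  shows "\<exists>fp c. fingerprints (independent_sets H \<inter> Pow W) (S * r) fp c \<and>
           (\<forall>I\<in>independent_sets H \<inter> Pow W. I \<subseteq> c I) \<and>
           (\<forall>J. c J \<subseteq> W \<and> (card (c J) < 2 * S \<or> \<not> two_thirds_full H m (c J) \<or>
              real (card (c J)) \<le> (1 - 1 / (4 * real S)) ^ r * real (card W)))"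
  using assms(1)
proof (induction r arbitrary: W)
  case 0
  show ?case
    by (intro exI[of _ "\<lambda>_. {}"] exI[of _ "\<lambda>_. W"]) (auto simp: fingerprints_def)
next
  case (Suc r)
  let ?x = "1 - 1 / (4 * real S)"
  have x: "0 \<le> ?x" using assms(4) by (simp add: field_simps)
  show ?case
  proof (cases "card W < 2 * S \<or> \<not> two_thirds_full H m W")
    case True
    then show ?thesis
      by (intro exI[of _ "\<lambda>_. {}"] exI[of _ "\<lambda>_. W"]) (auto simp: fingerprints_def)
  next
    case False
    then obtain f0 c0 where
      f0: "fingerprints (independent_sets H \<inter> Pow W) S f0 c0" and
      sup0: "\<And>I. I\<in>independent_sets H \<inter> Pow W \<Longrightarrow> I \<subseteq> c0 I" and
      c0: "\<And>J. c0 J \<subseteq> W" "\<And>J. real (card (c0 J)) \<le> ?x * real (card W)"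
      using shrink_once[OF Suc.prems assms(2-4)] by (auto simp: not_less)
    \<comment> \<open>The remaining rounds are prepared for every set that the first one may leave.\<close>
    have "\<forall>Y\<in>Pow W. \<exists>fp c. fingerprints (independent_sets H \<inter> Pow Y) (S * r) fp c \<and>
           (\<forall>I\<in>independent_sets H \<inter> Pow Y. I \<subseteq> c I) \<and>
           (\<forall>J. c J \<subseteq> Y \<and> (card (c J) < 2 * S \<or> \<not> two_thirds_full H m (c J) \<or>
              real (card (c J)) \<le> ?x ^ r * real (card Y)))"
      using Suc.IH Suc.prems by (auto dest: finite_subset)
    then obtain fp c where Y: "\<forall>Y\<in>Pow W.
           fingerprints (independent_sets H \<inter> Pow Y) (S * r) (fp Y) (c Y) \<and>
           (\<forall>I\<in>independent_sets H \<inter> Pow Y. I \<subseteq> c Y I) \<and>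
           (\<forall>J. c Y J \<subseteq> Y \<and> (card (c Y J) < 2 * S \<or> \<not> two_thirds_full H m (c Y J) \<or>
              real (card (c Y J)) \<le> ?x ^ r * real (card Y)))"
      unfolding bchoice_iff by (elim exE) (rule that)
    note Y' = Y[THEN bspec, OF PowI]
    note fp = Y'[THEN conjunct1]
      and sup = Y'[THEN conjunct2, THEN conjunct1, THEN bspec]
      and c = Y'[THEN conjunct2, THEN conjunct2, THEN spec, THEN conjunct1]
        Y'[THEN conjunct2, THEN conjunct2, THEN spec, THEN conjunct2]
    let ?f = "\<lambda>I. f0 I \<union> fp (c0 I) I" and ?c = "\<lambda>J. c (c0 J) J"
    have "fingerprints (independent_sets H \<inter> Pow W) (S * Suc r) ?f ?c"
      unfolding fingerprints_def
    proof (intro ballI)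
      fix I assume I: "I \<in> independent_sets H \<inter> Pow W"
      have I': "I \<in> independent_sets H \<inter> Pow (c0 I)" using I sup0[OF I] by auto
      note F0 = fingerprintsD[OF f0 I] and F = fingerprintsD[OF fp[OF c0(1)] I']
      have "card (?f I) \<le> S * Suc r"
        using card_Un_le[of "f0 I" "fp (c0 I) I"] F0(3) F(3) by simp
      moreover have "?c J = ?c I" if "?f I \<subseteq> J" "J \<subseteq> I" for J
      proof -
        have "c0 J = c0 I" using that by (intro F0(4)) auto
        moreover have "c (c0 I) J = c (c0 I) I" using that by (intro F(4)) auto
        ultimately show ?thesis by simp
      qed
      moreover have "?f I \<subseteq> I" "finite (?f I)" using F(1,2) F0(1,2) by simp_all
      ultimately show "?f I \<subseteq> I \<and> finite (?f I) \<and> card (?f I) \<le> S * Suc r \<and>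
          (\<forall>J. ?f I \<subseteq> J \<and> J \<subseteq> I \<longrightarrow> ?c J = ?c I)"
        by blast
    qed
    moreover have "I \<subseteq> ?c I" if "I \<in> independent_sets H \<inter> Pow W" for I
      using sup[OF c0(1), of I I] sup0[OF that] that by auto
    moreover have "?c J \<subseteq> W" for J using c(1)[OF c0(1)] c0(1) by blast
    moreover have "card (?c J) < 2 * S \<or> \<not> two_thirds_full H m (?c J) \<or>
        real (card (?c J)) \<le> ?x ^ Suc r * real (card W)" for J
    proof -
      have "?x ^ r * real (card (c0 J)) \<le> ?x ^ r * (?x * real (card W))"
        using x by (intro mult_left_mono c0) auto
      also have "\<dots> = ?x ^ Suc r * real (card W)" by (simp only: power_Suc mult_ac)
      finally have "?x ^ r * real (card (c0 J)) \<le> ?x ^ Suc r * real (card W)" .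
      then show ?thesis using c(2)[OF c0(1), of J J] by linarith
    qed
    ultimately show ?thesis by (intro exI[of _ ?f] exI[of _ ?c]) auto
  qed
qed

section \<open>A union bound over fingerprints\<close>

text \<open>
  A set \<open>T\<close> of the form \<open>\<Union>i\<in>K. I i\<close> contains the fingerprints \<open>F i\<close> of the \<open>I i\<close> and is covered by
  the containers \<open>c i (F i)\<close>. For fixed fingerprints, covering costs a factor \<open>1 - \<beta>\<close> for each of
  the remaining elements of \<open>T\<close>, compared with all sets \<open>T\<close> that contain the fingerprints. Summing
  over fingerprints in \<open>V\<close> and exchanging the sums leaves only the fingerprints inside a given
  \<open>T\<close> to be counted, so the bound on the proportion of such \<open>T\<close> does not depend on the size of \<open>V\<close>.
\<close>

lemma card_covered_sets:
  fixes \<beta> :: real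
  assumes V: "finite V" and K: "finite K" and \<beta>: "0 \<le> \<beta>" "\<beta> \<le> 1" and s: "card K * q \<le> s"
    and fp: "\<And>i. i \<in> K \<Longrightarrow> fingerprints (\<I> i) q (fp i) (c i)"
    and sup: "\<And>i I. i \<in> K \<Longrightarrow> I \<in> \<I> i \<Longrightarrow> I \<subseteq> c i I"
    and uncov: "\<And>F. \<beta> * real (card V) \<le> real (card (V - (\<Union>i\<in>K. c i (F i))))"
  shows "real (card {T. T \<subseteq> V \<and> card T = s \<and> (\<exists>I. T = (\<Union>i\<in>K. I i) \<and> (\<forall>i\<in>K. I i \<in> \<I> i))})
    \<le> (1 - \<beta>) ^ (s - card K * q) * real (s + 1) ^ (card K * q) * real (card V choose s)"
    (is "real (card ?bad) \<le> _")
proof -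
  define \<Phi> where "\<Phi> X = (\<Pi>\<^sub>E i\<in>K. {F. F \<subseteq> X \<and> card F \<le> q})" for X :: "'a set"
  define Y where "Y F = V \<inter> (\<Union>i\<in>K. c i (F i))" for F
  let ?G = "\<lambda>F. \<Union>i\<in>K. F i" and ?Sub = "{T. T \<subseteq> V \<and> card T = s}"
  let ?x = "(1 - \<beta>) ^ (s - card K * q)"
  have fin_\<Phi>: "finite (\<Phi> X)" if "finite X" for X
    unfolding \<Phi>_def using K that by (intro finite_PiE) auto
  have finSub: "finite ?Sub" using V by simp
  have card_\<Phi>: "card (\<Phi> T) \<le> (s + 1) ^ (card K * q)" if "T \<in> ?Sub" for T
  proof -
    have "finite T" using that V by (auto dest: finite_subset)
    have "card (\<Phi> T) = card {F. F \<subseteq> T \<and> card F \<le> q} ^ card K"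
      unfolding \<Phi>_def using K by (simp add: card_PiE)
    also have "\<dots> \<le> ((s + 1) ^ q) ^ card K"
      using card_small_subsets[OF \<open>finite T\<close>, of q] that by (intro power_mono) auto
    finally show ?thesis by (simp add: power_mult[symmetric] mult.commute)
  qed
  \<comment> \<open>The fingerprints of the parts witness that \<open>T\<close> is covered.\<close>
  have "?bad \<subseteq> (\<Union>F\<in>\<Phi> V. {T \<in> ?Sub. ?G F \<subseteq> T \<and> T \<subseteq> Y F})"
  proof
    fix T assume "T \<in> ?bad"
    then obtain I where T: "T \<subseteq> V" "card T = s" "T = (\<Union>i\<in>K. I i)" "\<forall>i\<in>K. I i \<in> \<I> i" by auto
    define F where "F = (\<lambda>i\<in>K. fp i (I i))"
    have FI: "F i \<subseteq> I i \<and> card (F i) \<le> q \<and> I i \<subseteq> c i (F i)" if i: "i \<in> K" for i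
    proof -
      note f = fingerprintsD[OF fp[OF i], of "I i"]
      have "c i (fp i (I i)) = c i (I i)" using f(1,4) T(4) i by blast
      then show ?thesis using f(1,3) sup[OF i, of "I i"] T(4) i by (simp add: F_def)
    qed
    have IT: "I i \<subseteq> T" if "i \<in> K" for i using that T(3) by blast
    have "F \<in> \<Phi> V"
      unfolding \<Phi>_def
    proof (rule PiE_I)
      fix i assume "i \<in> K"
      then show "F i \<in> {F. F \<subseteq> V \<and> card F \<le> q}" using FI IT T(1) by blast
    qed (simp add: F_def)
    moreover have "?G F \<subseteq> T" using FI IT by blast
    moreover have "T \<subseteq> Y F" using FI T(1,3) unfolding Y_def by blast
    ultimately show "T \<in> (\<Union>F\<in>\<Phi> V. {T \<in> ?Sub. ?G F \<subseteq> T \<and> T \<subseteq> Y F})" using T(1,2) by blast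
  qed
  then have "card ?bad \<le> card (\<Union>F\<in>\<Phi> V. {T \<in> ?Sub. ?G F \<subseteq> T \<and> T \<subseteq> Y F})"
  proof (rule card_mono[rotated])
    show "finite (\<Union>F\<in>\<Phi> V. {T \<in> ?Sub. ?G F \<subseteq> T \<and> T \<subseteq> Y F})"
      by (rule finite_subset[OF _ finSub]) blast
  qed
  also have "\<dots> \<le> (\<Sum>F\<in>\<Phi> V. card {T \<in> ?Sub. ?G F \<subseteq> T \<and> T \<subseteq> Y F})"
    using fin_\<Phi>[OF V] by (rule card_UN_le)
  finally have "real (card ?bad) \<le> (\<Sum>F\<in>\<Phi> V. real (card {T \<in> ?Sub. ?G F \<subseteq> T \<and> T \<subseteq> Y F}))"
    unfolding of_nat_sum[symmetric] by (rule of_nat_mono)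
  also have "\<dots> \<le> (\<Sum>F\<in>\<Phi> V. ?x * real (card {T \<in> ?Sub. ?G F \<subseteq> T}))"
  proof (rule sum_mono)
    fix F assume F: "F \<in> \<Phi> V"
    have GV: "?G F \<subseteq> V" using F by (auto simp: \<Phi>_def PiE_def Pi_def)
    have "card (?G F) \<le> (\<Sum>i\<in>K. card (F i))" using K by (rule card_UN_le)
    also have "\<dots> \<le> (\<Sum>i\<in>K. q)" using F by (intro sum_mono) (auto simp: \<Phi>_def PiE_def Pi_def)
    finally have g: "card (?G F) \<le> card K * q" by simp
    have fY: "finite (Y F)" "Y F \<subseteq> V" using V by (auto simp: Y_def)
    show "real (card {T \<in> ?Sub. ?G F \<subseteq> T \<and> T \<subseteq> Y F}) \<le> ?x * real (card {T \<in> ?Sub. ?G F \<subseteq> T})"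
    proof (cases "?G F \<subseteq> Y F")
      case False
      then have none: "{T \<in> ?Sub. ?G F \<subseteq> T \<and> T \<subseteq> Y F} = {}" by blast
      show ?thesis unfolding none using \<beta> by simp
    next
      case True
      have "V - Y F = V - (\<Union>i\<in>K. c i (F i))" by (auto simp: Y_def)
      then have "\<beta> * real (card V) \<le> real (card (V - Y F))" using uncov[of F] by simp
      also have "\<dots> = real (card V) - real (card (Y F))"
        using fY card_mono[OF V fY(2)] by (simp add: card_Diff_subset of_nat_diff)
      finally have "real (card (Y F)) \<le> (1 - \<beta>) * real (card V)" by (simp add: algebra_simps)
      moreover have "card (?G F) \<le> card (Y F)" using True fY by (rule_tac card_mono)
      moreover have "card (Y F) \<le> card V" using fY V by (rule_tac card_mono)
      moreover have "0 \<le> \<beta> * real (card (?G F))" using \<beta> by simp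
      ultimately have scaled: "real (card (Y F) - card (?G F)) \<le> (1 - \<beta>) * real (card V - card (?G F))"
        by (simp add: of_nat_diff algebra_simps)
      have e1: "{T \<in> ?Sub. ?G F \<subseteq> T \<and> T \<subseteq> Y F} = {T. ?G F \<subseteq> T \<and> T \<subseteq> Y F \<and> card T = s}"
        using fY(2) by blast
      have e2: "{T \<in> ?Sub. ?G F \<subseteq> T} = {T. ?G F \<subseteq> T \<and> T \<subseteq> V \<and> card T = s}" by blast
      have gs: "card (?G F) \<le> s" using g s by simp
      have "real (card {T \<in> ?Sub. ?G F \<subseteq> T \<and> T \<subseteq> Y F})
          = real ((card (Y F) - card (?G F)) choose (s - card (?G F)))"
        unfolding e1 card_sets_between[OF fY(1) True gs] ..
      also have "\<dots> \<le> (1 - \<beta>) ^ (s - card (?G F)) * real ((card V - card (?G F)) choose (s - card (?G F)))"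
        using \<beta> scaled by (intro binomial_scaled_le) auto
      also have "\<dots> \<le> ?x * real ((card V - card (?G F)) choose (s - card (?G F)))"
        using \<beta> g by (intro mult_right_mono power_decreasing) auto
      also have "real ((card V - card (?G F)) choose (s - card (?G F))) = real (card {T \<in> ?Sub. ?G F \<subseteq> T})"
        unfolding e2 card_sets_between[OF V GV gs] ..
      finally show ?thesis .
    qed
  qed
  also have "\<dots> = ?x * real (\<Sum>F\<in>\<Phi> V. card {T \<in> ?Sub. ?G F \<subseteq> T})"
    by (simp add: sum_distrib_left)
  \<comment> \<open>Double counting of the pairs of a sample and fingerprints inside it.\<close>
  also have "(\<Sum>F\<in>\<Phi> V. card {T \<in> ?Sub. ?G F \<subseteq> T}) = (\<Sum>T\<in>?Sub. card {F \<in> \<Phi> V. ?G F \<subseteq> T})"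
    using fin_\<Phi>[OF V] finSub by (intro sum_multicount_gen) auto
  also have "?x * real (\<Sum>T\<in>?Sub. card {F \<in> \<Phi> V. ?G F \<subseteq> T})
      \<le> ?x * real (\<Sum>T\<in>?Sub. (s + 1) ^ (card K * q))"
  proof (intro mult_left_mono of_nat_mono sum_mono)
    fix T assume T: "T \<in> ?Sub"
    have "{F \<in> \<Phi> V. ?G F \<subseteq> T} \<subseteq> \<Phi> T" by (auto simp: \<Phi>_def PiE_def Pi_def)
    moreover have "finite (\<Phi> T)" using T V by (intro fin_\<Phi>) (auto dest: finite_subset)
    ultimately show "card {F \<in> \<Phi> V. ?G F \<subseteq> T} \<le> (s + 1) ^ (card K * q)"
      using card_mono card_\<Phi>[OF T] le_trans by blast
  qed (use \<beta> in auto)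
  also have "(\<Sum>T\<in>?Sub. (s + 1) ^ (card K * q)) = (card V choose s) * (s + 1) ^ (card K * q)"
    using n_subsets[OF V] by simp
  finally show ?thesis by (simp add: mult_ac)
qed

section \<open>Relational structures and partition properties\<close>

text \<open>
  A term for the copy of a structure along an injective map, in place of the existential statement
  that a copy exists: copies can then be composed, and they commute with induced structures.
\<close>

definition relabel :: "('v \<Rightarrow> 'w) \<Rightarrow> 'v rstruct \<Rightarrow> 'w rstruct" where
  "relabel f A = \<lparr>verts = f ` verts A, rels = map ((`) (map f)) (rels A)\<rparr>"

lemma isomorphic_iff_relabel: "isomorphic A B \<longleftrightarrow> (\<exists>f. inj_on f (verts A) \<and> B = relabel f A)"
proof -
  have "B = relabel f A \<longleftrightarrow> f ` verts A = verts B \<and> rels B = map ((`) (map f)) (rels A)" for f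
    by (cases B) (auto simp: relabel_def)
  then show ?thesis unfolding isomorphic_def bij_betw_def by blast
qed

lemma finite_structure_tuple:
  assumes "finite_structure \<tau> A" "r < length \<tau>" "t \<in> rels A ! r"
  shows "length t = \<tau> ! r" "set t \<subseteq> verts A"
  using assms unfolding finite_structure_def by blast+

lemma finite_structure_rels_subset:
  assumes "finite_structure \<tau> A" "R \<in> set (rels A)" "t \<in> R"
  shows "set t \<subseteq> verts A"
proof -
  obtain r where "r < length (rels A)" "R = rels A ! r" using assms(2) by (metis in_set_conv_nth)
  moreover from this have "r < length \<tau>" using assms(1) by (simp add: finite_structure_def)
  ultimately show ?thesis using finite_structure_tuple(2)[OF assms(1)] assms(3) by blast
qed

lemma finite_structure_relabel:
  assumes "finite_structure \<tau> A"
  shows "finite_structure \<tau> (relabel f A)"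
  unfolding finite_structure_def
proof (intro conjI allI impI)
  fix r assume "r < length \<tau>"
  moreover from this have "r < length (rels A)" using assms by (simp add: finite_structure_def)
  ultimately show "rels (relabel f A) ! r \<subseteq> {t. length t = \<tau> ! r \<and> set t \<subseteq> verts (relabel f A)}"
    using finite_structure_tuple[OF assms, of r] by (auto simp: relabel_def image_subset_iff)
qed (use assms in \<open>auto simp: finite_structure_def relabel_def\<close>)

lemma relabel_id_on:
  assumes "finite_structure \<tau> A" "\<And>x. x \<in> verts A \<Longrightarrow> f x = x"
  shows "relabel f A = A"
proof -
  have "map f ` R = R" if "R \<in> set (rels A)" for R
  proof -
    have "map f t = t" if "t \<in> R" for t
      using finite_structure_rels_subset[OF assms(1) \<open>R \<in> set (rels A)\<close> that] assms(2)
      by (auto intro: map_idI)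
    then show ?thesis by simp
  qed
  then have "map ((`) (map f)) (rels A) = rels A" by (intro map_idI) auto
  moreover have "f ` verts A = verts A" using assms(2) by simp
  ultimately show ?thesis by (simp add: relabel_def)
qed

lemma relabel_relabel: "relabel g (relabel f A) = relabel (g \<circ> f) A"
proof -
  have "map ((`) (map g) \<circ> (`) (map f)) L = map ((`) (map (g \<circ> f))) L" for L
    by (rule map_cong) (auto simp: image_image)
  then show ?thesis by (simp add: relabel_def image_image)
qed

lemma isomorphic_sym:
  assumes "finite_structure \<tau> A" "isomorphic A B"
  shows "isomorphic B A"
proof -
  obtain f where f: "inj_on f (verts A)" "B = relabel f A"
    using assms(2) by (auto simp: isomorphic_iff_relabel)
  let ?g = "the_inv_into (verts A) f"
  have "relabel ?g B = A"
    unfolding f relabel_relabel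
    by (rule relabel_id_on[OF assms(1)]) (simp add: the_inv_into_f_f[OF f(1)])
  moreover have "inj_on ?g (verts B)"
    using inj_on_the_inv_into[OF f(1)] by (simp add: f(2) relabel_def)
  ultimately show ?thesis by (metis isomorphic_iff_relabel)
qed

lemma induced_relabel:
  assumes "finite_structure \<tau> A" "inj_on f (verts A)" "U \<subseteq> verts A"
  shows "induced (relabel f A) (f ` U) = relabel f (induced A U)"
proof -
  have "{t \<in> map f ` R. set t \<subseteq> f ` U} = map f ` {t \<in> R. set t \<subseteq> U}" if "R \<in> set (rels A)" for R
  proof -
    have "f ` set t \<subseteq> f ` U \<longleftrightarrow> set t \<subseteq> U" if "t \<in> R" for t
      using finite_structure_rels_subset[OF assms(1) \<open>R \<in> set (rels A)\<close> that] assms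
      by (intro inj_on_image_subset_iff) auto
    then have "{t \<in> R. f ` set t \<subseteq> f ` U} = {t \<in> R. set t \<subseteq> U}" by blast
    moreover have "{t \<in> map f ` R. set t \<subseteq> f ` U} = map f ` {t \<in> R. f ` set t \<subseteq> f ` U}" by auto
    ultimately show ?thesis by simp
  qed
  then show ?thesis by (simp add: induced_def relabel_def)
qed

lemma verts_induced [simp]: "verts (induced A U) = U"
  by (simp add: induced_def)

lemma length_rels_induced [simp]: "length (rels (induced A U)) = length (rels A)"
  by (simp add: induced_def)

lemma rels_induced_nth [simp]:
  "r < length (rels A) \<Longrightarrow> rels (induced A U) ! r = {t \<in> rels A ! r. set t \<subseteq> U}"
  by (simp add: induced_def)

lemma induced_induced: "W \<subseteq> U \<Longrightarrow> induced (induced A U) W = induced A W"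
  by (auto simp: induced_def)

lemma induced_self:
  assumes "finite_structure \<tau> A"
  shows "induced A (verts A) = A"
proof -
  have "{t \<in> R. set t \<subseteq> verts A} = R" if "R \<in> set (rels A)" for R
    using finite_structure_rels_subset[OF assms that] by blast
  then have "map (\<lambda>R. {t \<in> R. set t \<subseteq> verts A}) (rels A) = rels A" by (intro map_idI) auto
  then show ?thesis by (simp add: induced_def)
qed

lemma finite_structure_induced:
  assumes "finite_structure \<tau> A" "U \<subseteq> verts A"
  shows "finite_structure \<tau> (induced A U)"
  using assms finite_structure_tuple[OF assms(1)] finite_subset[OF assms(2)]
  by (auto simp: finite_structure_def)

lemma rstruct_eqI:
  assumes "verts A = verts B" "length (rels A) = length (rels B)"
    "\<And>r. r < length (rels A) \<Longrightarrow> rels A ! r = rels B ! r"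
  shows "A = (B :: 'v rstruct)"
proof -
  have "rels A = rels B" using assms(2,3) by (intro nth_equalityI) auto
  then show ?thesis using assms(1) by simp
qed

lemma is_propertyD:
  assumes "is_property \<tau> P" "A \<in> P"
  shows "finite_structure \<tau> A"
    and "\<lbrakk>finite_structure \<tau> B; isomorphic A B\<rbrakk> \<Longrightarrow> B \<in> P"
  using assms unfolding is_property_def by blast+

lemma hereditary_Part:
  assumes "\<And>i. i \<in> {1..k} \<Longrightarrow> hereditary (P i)"
  shows "hereditary (Part \<tau> k P)"
  unfolding hereditary_def
proof (intro ballI allI impI)
  fix A U assume A: "A \<in> Part \<tau> k P" and U: "U \<subseteq> verts A"
  then obtain V where V: "(\<Union>i\<in>{1..k}. V i) = verts A" "disjoint_family_on V {1..k}"
    "\<forall>i\<in>{1..k}. induced A (V i) \<in> P i" "finite_structure \<tau> A" by (auto simp: Part_def)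
  have "induced (induced A U) (V i \<inter> U) \<in> P i" if i: "i \<in> {1..k}" for i
  proof -
    have "induced (induced A (V i)) (V i \<inter> U) \<in> P i"
      using assms[OF i] V(3) i unfolding hereditary_def by (metis Int_lower1 verts_induced)
    then show ?thesis by (simp add: induced_induced)
  qed
  moreover have "(\<Union>i\<in>{1..k}. V i \<inter> U) = U" using V(1) U by auto
  moreover have "disjoint_family_on (\<lambda>i. V i \<inter> U) {1..k}"
    using V(2) by (auto simp: disjoint_family_on_def)
  ultimately show "induced A U \<in> Part \<tau> k P"
    using finite_structure_induced[OF V(4) U] by (auto simp: Part_def intro!: exI[of _ "\<lambda>i. V i \<inter> U"])
qed

lemma is_property_Part:
  assumes "\<And>i. i \<in> {1..k} \<Longrightarrow> is_property \<tau> (P i)"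
  shows "is_property \<tau> (Part \<tau> k P)"
  unfolding is_property_def
proof (intro conjI ballI allI impI)
  fix A B :: "nat rstruct" assume A: "A \<in> Part \<tau> k P" and B: "finite_structure \<tau> B \<and> isomorphic A B"
  obtain V where V: "(\<Union>i\<in>{1..k}. V i) = verts A" "disjoint_family_on V {1..k}"
    "\<forall>i\<in>{1..k}. induced A (V i) \<in> P i" "finite_structure \<tau> A" using A by (auto simp: Part_def)
  obtain f where f: "inj_on f (verts A)" "B = relabel f A"
    using B by (auto simp: isomorphic_iff_relabel)
  have sub: "V i \<subseteq> verts A" if "i \<in> {1..k}" for i using V(1) that by auto
  have "induced B (f ` V i) \<in> P i" if i: "i \<in> {1..k}" for i
  proof -
    have "induced B (f ` V i) = relabel f (induced A (V i))"
      unfolding f(2) using V(4) f(1) sub[OF i] by (rule induced_relabel)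
    moreover have "isomorphic (induced A (V i)) (relabel f (induced A (V i)))"
      using inj_on_subset[OF f(1) sub[OF i]] by (auto simp: isomorphic_iff_relabel)
    moreover have "finite_structure \<tau> (relabel f (induced A (V i)))"
      using V(4) sub[OF i] by (intro finite_structure_relabel finite_structure_induced)
    ultimately show ?thesis using is_propertyD(2)[OF assms[OF i]] V(3) i by metis
  qed
  moreover have "(\<Union>i\<in>{1..k}. f ` V i) = verts B"
    unfolding image_UN[symmetric] V(1) by (simp add: f(2) relabel_def)
  moreover have "disjoint_family_on (\<lambda>i. f ` V i) {1..k}"
    using V(2) sub f(1) unfolding disjoint_family_on_def
    by (metis image_empty inj_on_image_Int)
  ultimately show "B \<in> Part \<tau> k P"
    using B by (auto simp: Part_def intro!: exI[of _ "\<lambda>i. f ` V i"])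
qed (auto simp: Part_def)

text \<open>
  The collection of types that the tester for the partition property rejects is a legitimate one:
  non-membership is invariant under isomorphism because isomorphism is symmetric.
\<close>

lemma is_property_sample_complement:
  assumes "is_property \<tau> P"
  shows "is_property \<tau> {A. finite_structure \<tau> A \<and> card (verts A) = s \<and> A \<notin> P}"
  unfolding is_property_def
proof (intro conjI ballI allI impI)
  fix A B :: "nat rstruct"
  assume A: "A \<in> {A. finite_structure \<tau> A \<and> card (verts A) = s \<and> A \<notin> P}"
    and B: "finite_structure \<tau> B \<and> isomorphic A B"
  have "card (verts B) = card (verts A)"
    using B by (auto simp: isomorphic_def dest: bij_betw_same_card)
  moreover have "isomorphic B A" using A B isomorphic_sym by blast
  then have "B \<notin> P" using assms A unfolding is_property_def by blast
  ultimately show "B \<in> {A. finite_structure \<tau> A \<and> card (verts A) = s \<and> A \<notin> P}" using A B by simp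
qed auto

text \<open>
  Extendability provides new vertices with arbitrary names; relabelling turns them into the
  elements of \<open>Z\<close> while fixing the old vertices.
\<close>

lemma extend_onto:
  assumes "is_property \<tau> P" "extendable P" "B \<in> P" "finite Z" "verts B \<inter> Z = {}"
  obtains D where "D \<in> P" "verts D = verts B \<union> Z" "induced D (verts B) = B"
proof -
  have "\<exists>D\<in>P. card (verts D) = card (verts B) + card Z \<and> verts B \<subseteq> verts D \<and>
      induced D (verts B) = B"
    by (rule assms(2)[unfolded extendable_def, THEN bspec, OF assms(3), THEN spec])
  then obtain D where D: "D \<in> P" "card (verts D) = card (verts B) + card Z"
      "verts B \<subseteq> verts D" "induced D (verts B) = B"
    by (elim bexE conjE) (rule that)
  have fin: "finite_structure \<tau> D" "finite_structure \<tau> B"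
    using is_propertyD(1)[OF assms(1)] assms(3) D(1) by blast+
  have fv: "finite (verts D)" "finite (verts B)" using fin by (auto simp: finite_structure_def)
  have "card (verts D - verts B) = card Z" using D fv by (simp add: card_Diff_subset)
  then obtain g where g: "bij_betw g (verts D - verts B) Z"
    using finite_same_card_bij[of "verts D - verts B" Z] fv assms(4) by auto
  define f where "f x = (if x \<in> verts B then x else g x)" for x
  have "bij_betw f (verts B \<union> (verts D - verts B)) (verts B \<union> Z)"
  proof (rule bij_betw_combine)
    show "bij_betw f (verts B) (verts B)" by (rule bij_betw_cong[THEN iffD2, OF _ bij_betw_id]) (simp add: f_def)
    show "bij_betw f (verts D - verts B) Z" using g by (rule bij_betw_cong[THEN iffD1, rotated]) (simp add: f_def)
  qed (rule assms)
  moreover have "verts B \<union> (verts D - verts B) = verts D" using D(3) by auto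
  ultimately have f: "inj_on f (verts D)" "f ` verts D = verts B \<union> Z" by (auto simp: bij_betw_def)
  have fB: "f ` verts B = verts B" by (simp add: f_def)
  show thesis
  proof
    show "relabel f D \<in> P"
      using is_propertyD(2)[OF assms(1) D(1)] f(1) finite_structure_relabel[OF fin(1)]
      unfolding isomorphic_iff_relabel by blast
    show "verts (relabel f D) = verts B \<union> Z" using f(2) by (simp add: relabel_def)
    have "induced (relabel f D) (verts B) = relabel f (induced D (verts B))"
      using induced_relabel[OF fin(1) f(1) D(3)] fB by simp
    also have "\<dots> = B" unfolding D(4) by (rule relabel_id_on[OF fin(2)]) (simp add: f_def)
    finally show "induced (relabel f D) (verts B) = B" .
  qed
qed

section \<open>Gluing close structures along a partition\<close>

lemma card_pairs_meeting:
  assumes "finite V" "Z \<subseteq> V"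
  shows "card {t. length t = 2 \<and> set t \<subseteq> V \<and> set t \<inter> Z \<noteq> {}} \<le> 2 * card Z * card V"
proof -
  let ?f = "\<lambda>(z, v). [z, v]" and ?g = "\<lambda>(z, v). [v, z]"
  have fin: "finite (Z \<times> V)" using assms by (auto dest: finite_subset)
  have "{t. length t = 2 \<and> set t \<subseteq> V \<and> set t \<inter> Z \<noteq> {}} \<subseteq> ?f ` (Z \<times> V) \<union> ?g ` (Z \<times> V)"
  proof clarify
    fix t assume t: "length t = 2" "set t \<subseteq> V" "set t \<inter> Z \<noteq> {}" "t \<notin> ?g ` (Z \<times> V)"
    then obtain x y where xy: "t = [x, y]" by (auto simp: numeral_2_eq_2 length_Suc_conv)
    show "t \<in> ?f ` (Z \<times> V)"
    proof (cases "x \<in> Z")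
      case True
      then show ?thesis using t xy by (intro image_eqI[of _ _ "(x, y)"]) auto
    next
      case False
      then have "t \<in> ?g ` (Z \<times> V)" using t xy by (intro image_eqI[of _ _ "(y, x)"]) auto
      then show ?thesis using t by simp
    qed
  qed
  then have "card {t. length t = 2 \<and> set t \<subseteq> V \<and> set t \<inter> Z \<noteq> {}}
      \<le> card (?f ` (Z \<times> V) \<union> ?g ` (Z \<times> V))"
    using fin by (intro card_mono) auto
  also have "\<dots> \<le> card (?f ` (Z \<times> V)) + card (?g ` (Z \<times> V))" by (rule card_Un_le)
  also have "\<dots> \<le> card (Z \<times> V) + card (Z \<times> V)" using fin by (intro add_mono card_image_le)
  finally show ?thesis by (simp add: card_cartesian_product)
qed

lemma binary_struct_dist:
  assumes "\<forall>a\<in>set \<tau>. a = 2"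
  shows "struct_dist \<tau> A B = 
    (\<Sum>r<length \<tau>. real (card (sym_diff (rels A ! r) (rels B ! r)))) /
      (real (length \<tau>) * real (card (verts A)) ^ 2)"
proof -
  have "(\<Sum>r<length \<tau>. real (card (sym_diff (rels A ! r) (rels B ! r))) / real (card (verts A)) ^ (\<tau> ! r))
      = (\<Sum>r<length \<tau>. real (card (sym_diff (rels A ! r) (rels B ! r))) / real (card (verts A)) ^ 2)"
  proof (rule sum.cong[OF refl])
    fix r assume "r \<in> {..<length \<tau>}"
    then have "\<tau> ! r = 2" using assms nth_mem[of r \<tau>] by auto
    then show "real (card (sym_diff (rels A ! r) (rels B ! r))) / real (card (verts A)) ^ (\<tau> ! r)
        = real (card (sym_diff (rels A ! r) (rels B ! r))) / real (card (verts A)) ^ 2" by simp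
  qed
  then show ?thesis by (simp add: struct_dist_def sum_divide_distrib[symmetric])
qed

text \<open>
  Multiplying out the denominator is valid even where it vanishes: over the empty vertex set there
  are no tuples of length two, so both sides are zero.
\<close>

lemma binary_struct_dist_le_iff:
  assumes "\<forall>a\<in>set \<tau>. a = 2" "finite_structure \<tau> A" "finite_structure \<tau> B" "verts B = verts A" "0 \<le> \<delta>"
  shows "struct_dist \<tau> A B \<le> \<delta> \<longleftrightarrow>
    (\<Sum>r<length \<tau>. real (card (sym_diff (rels A ! r) (rels B ! r)))) \<le> \<delta> * (real (length \<tau>) * real (card (verts A)) ^ 2)"
proof (cases "length \<tau> = 0 \<or> verts A = {}")
  case True
  have "real (card (sym_diff (rels A ! r) (rels B ! r))) = 0" if "verts A = {}" "r < length \<tau>" for r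
  proof -
    have no: "t \<notin> rels C ! r" if "finite_structure \<tau> C" "verts C = {}" for C :: "'a rstruct" and t
    proof
      assume "t \<in> rels C ! r"
      then have "length t = \<tau> ! r" "set t \<subseteq> {}"
        using finite_structure_tuple[OF that(1) \<open>r < length \<tau>\<close>] that(2) by auto
      then show False using assms(1) nth_mem[OF \<open>r < length \<tau>\<close>] by auto
    qed
    have "rels A ! r = {}" "rels B ! r = {}"
      using no[OF assms(2)] no[OF assms(3)] that(1) assms(4) by auto
    then show ?thesis by simp
  qed
  then have "verts A = {} \<Longrightarrow> (\<Sum>r<length \<tau>. real (card (sym_diff (rels A ! r) (rels B ! r)))) = 0"
    by (intro sum.neutral) auto
  then show ?thesis using True assms(5) unfolding binary_struct_dist[OF assms(1)] by auto
next
  case False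
  then have "0 < real (length \<tau>) * real (card (verts A)) ^ 2"
    using assms(2) by (auto simp: finite_structure_def card_gt_0_iff)
  then show ?thesis unfolding binary_struct_dist[OF assms(1)] by (simp add: pos_divide_le_eq)
qed

text \<open>
  The sets \<open>U i\<close> are made disjoint by deleting from each one the earlier ones; heredity keeps the
  restriction of \<open>B i\<close> in \<open>P i\<close>. The uncovered vertices \<open>Z\<close> join the first part by extendability.
  The glued structure agrees with \<open>A\<close> on all tuples that do not lie inside one part, so the two
  differ only where some \<open>B i\<close> differs from \<open>A\<close> or on pairs that meet \<open>Z\<close>. There are at most
  \<open>2 \<zeta> n\<^sup>2\<close> such pairs.
\<close>

lemma glue_parts:
  assumes bin: "\<forall>a\<in>set \<tau>. a = 2" and A: "finite_structure \<tau> A" and k: "1 \<le> k"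
    and property: "\<And>i. i \<in> {1..k} \<Longrightarrow> is_property \<tau> (P i)"
    and her: "\<And>i. i \<in> {1..k} \<Longrightarrow> hereditary (P i)" and ext: "extendable (P 1)"
    and U: "\<And>i. i \<in> {1..k} \<Longrightarrow> U i \<subseteq> verts A"
    and B: "\<And>i. i \<in> {1..k} \<Longrightarrow> B i \<in> P i" "\<And>i. i \<in> {1..k} \<Longrightarrow> verts (B i) = U i"
    and \<delta>: "0 \<le> \<delta>" "\<And>i. i \<in> {1..k} \<Longrightarrow> struct_dist \<tau> (induced A (U i)) (B i) \<le> \<delta>"
    and Z: "Z = verts A - (\<Union>i\<in>{1..k}. U i)"
    and z: "real (card Z) \<le> \<zeta> * real (card (verts A))" "0 \<le> \<zeta>"
  shows "\<exists>G\<in>Part \<tau> k P. verts G = verts A \<and> struct_dist \<tau> A G \<le> real k * \<delta> + 2 * \<zeta>"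
proof -
  let ?l = "length \<tau>" and ?n = "real (card (verts A))"
  have finA: "finite (verts A)" and lA: "length (rels A) = ?l" using A by (auto simp: finite_structure_def)
  have finZ: "finite Z" using finA Z by simp
  have finB: "finite_structure \<tau> (B i)" if "i \<in> {1..k}" for i
    using is_propertyD(1)[OF property[OF that] B(1)[OF that]] .
  have lB: "length (rels (B i)) = ?l" if "i \<in> {1..k}" for i
    using finB[OF that] by (simp add: finite_structure_def)
  define V where "V i = U i - (\<Union>j\<in>{1..<i}. U j)" for i
  have VU: "V i \<subseteq> U i" for i by (auto simp: V_def)
  have V_disj: "V i \<inter> V j = {}" if "i \<in> {1..k}" "j \<in> {1..k}" "i \<noteq> j" for i j
    using that unfolding V_def by (cases i j rule: linorder_cases) auto
  have V_cover: "(\<Union>i\<in>{1..k}. V i) = (\<Union>i\<in>{1..k}. U i)"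
  proof
    show "(\<Union>i\<in>{1..k}. U i) \<subseteq> (\<Union>i\<in>{1..k}. V i)"
    proof
      fix x assume "x \<in> (\<Union>i\<in>{1..k}. U i)"
      then have ex: "\<exists>i. i \<in> {1..k} \<and> x \<in> U i" by auto
      define i where "i = (LEAST i. i \<in> {1..k} \<and> x \<in> U i)"
      have i: "i \<in> {1..k} \<and> x \<in> U i" unfolding i_def using ex by (rule LeastI_ex)
      have "x \<notin> U j" if "j \<in> {1..<i}" for j
        using not_less_Least[of j "\<lambda>i. i \<in> {1..k} \<and> x \<in> U i"] that i unfolding i_def[symmetric] by auto
      then have "x \<in> V i" using i by (auto simp: V_def)
      then show "x \<in> (\<Union>i\<in>{1..k}. V i)" using i by blast
    qed
  qed (use VU in auto)
  have VA: "V i \<subseteq> verts A" if "i \<in> {1..k}" for i using VU U[OF that] by blast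
  have ZV: "Z \<inter> V i = {}" if "i \<in> {1..k}" for i using VU[of i] that unfolding Z by blast
  have B1: "induced (B i) (V i) \<in> P i" if "i \<in> {1..k}" for i
    using her[OF that] B[OF that] VU unfolding hereditary_def by simp
  have one: "1 \<in> {1..k}" using k by simp
  \<comment> \<open>The first part absorbs the uncovered vertices.\<close>
  obtain D where D: "D \<in> P 1" "verts D = V 1 \<union> Z" "induced D (V 1) = induced (B 1) (V 1)"
    using extend_onto[OF property[OF one] ext B1[OF one] finZ] ZV[OF one] by auto
  define Q where "Q i = (if i = 1 then D else induced (B i) (V i))" for i
  define W where "W i = (if i = 1 then V 1 \<union> Z else V i)" for i
  have QP: "Q i \<in> P i" if "i \<in> {1..k}" for i using D(1) B1[OF that] by (simp add: Q_def)
  have QW: "verts (Q i) = W i" for i using D(2) by (simp add: Q_def W_def)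
  have QB: "induced (Q i) (V i) = induced (B i) (V i)" for i
    using D(3) by (auto simp: Q_def induced_induced)
  have finQ: "finite_structure \<tau> (Q i)" if "i \<in> {1..k}" for i
    using is_propertyD(1)[OF property[OF that] QP[OF that]] .
  have lQ: "length (rels (Q i)) = ?l" if "i \<in> {1..k}" for i
    using finQ[OF that] by (simp add: finite_structure_def)
  have W_disj: "W i \<inter> W j = {}" if "i \<in> {1..k}" "j \<in> {1..k}" "i \<noteq> j" for i j
    using V_disj[OF that] ZV[OF that(1)] ZV[OF that(2)] that(3) by (auto simp: W_def)
  have W_V: "W i \<subseteq> V i \<union> Z" for i by (auto simp: W_def)
  have W_cover: "(\<Union>i\<in>{1..k}. W i) = verts A"
  proof
    show "(\<Union>i\<in>{1..k}. W i) \<subseteq> verts A" using W_V VA Z by blast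
    have "V i \<subseteq> W i" for i by (auto simp: W_def)
    then have "(\<Union>i\<in>{1..k}. U i) \<subseteq> (\<Union>i\<in>{1..k}. W i)" unfolding V_cover[symmetric] by blast
    moreover have "Z \<subseteq> W 1" by (simp add: W_def)
    moreover have "W 1 \<subseteq> (\<Union>i\<in>{1..k}. W i)" using one by (rule UN_upper)
    moreover have "verts A \<subseteq> (\<Union>i\<in>{1..k}. U i) \<union> Z" by (auto simp: Z)
    ultimately show "verts A \<subseteq> (\<Union>i\<in>{1..k}. W i)" by (meson Un_least order_trans)
  qed
  \<comment> \<open>Keep every tuple of \<open>A\<close> that is inside no part; inside part \<open>i\<close> use \<open>Q i\<close>.\<close>
  define G where "G = \<lparr>verts = verts A, rels = map (\<lambda>r.
      {t \<in> rels A ! r. \<forall>i\<in>{1..k}. \<not> set t \<subseteq> W i} \<union> (\<Union>i\<in>{1..k}. rels (Q i) ! r)) [0..<?l]\<rparr>"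
  have vG: "verts G = verts A" and lG: "length (rels G) = ?l" by (simp_all add: G_def)
  have rG: "rels G ! r = {t \<in> rels A ! r. \<forall>i\<in>{1..k}. \<not> set t \<subseteq> W i} \<union> (\<Union>i\<in>{1..k}. rels (Q i) ! r)"
    if "r < ?l" for r using that by (simp add: G_def)
  have ar: "\<tau> ! r = 2" if "r < ?l" for r using bin nth_mem[OF that] by blast
  have tQ: "length t = 2 \<and> set t \<subseteq> W i" if "r < ?l" "i \<in> {1..k}" "t \<in> rels (Q i) ! r" for r t i
    using finite_structure_tuple[OF finQ[OF that(2)] that(1,3)] unfolding QW ar[OF that(1)] by simp
  have tA: "length t = 2 \<and> set t \<subseteq> verts A" if "r < ?l" "t \<in> rels A ! r" for r t
    using finite_structure_tuple[OF A that] unfolding ar[OF that(1)] by simp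
  have tG: "length t = 2 \<and> set t \<subseteq> verts A" if "r < ?l" "t \<in> rels G ! r" for r t
    using that(2) tQ[OF that(1)] tA[OF that(1)] W_cover unfolding rG[OF that(1)] by blast
  have finG: "finite_structure \<tau> G"
    unfolding finite_structure_def vG using finA lG tG ar by simp blast
  have G_in: "t \<in> rels G ! r \<longleftrightarrow> t \<in> rels (Q i) ! r"
    if r: "r < ?l" and i: "i \<in> {1..k}" and t: "set t \<subseteq> W i" "length t = 2" for r i t
  proof
    assume "t \<in> rels G ! r"
    then obtain j where j: "j \<in> {1..k}" "t \<in> rels (Q j) ! r"
      using t i unfolding rG[OF r] by auto
    have "t \<noteq> []" using t by auto
    then obtain x where "x \<in> set t" by (cases t) auto
    then have "x \<in> W i \<inter> W j" using t tQ[OF r j] by auto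
    then have "i = j" using W_disj[OF i j(1)] by auto
    then show "t \<in> rels (Q i) ! r" using j by simp
  qed (use i in \<open>auto simp: rG[OF r]\<close>)
  have "induced G (W i) = Q i" if i: "i \<in> {1..k}" for i
  proof (rule rstruct_eqI)
    fix r assume "r < length (rels (induced G (W i)))"
    then have r: "r < ?l" using lG by simp
    then have "rels (induced G (W i)) ! r = {t \<in> rels G ! r. set t \<subseteq> W i}" using lG by simp
    also have "\<dots> = rels (Q i) ! r"
      using G_in[OF r i] tQ[OF r i] tG[OF r] by blast
    finally show "rels (induced G (W i)) ! r = rels (Q i) ! r" .
  qed (use QW lQ[OF i] lG in auto)
  then have "\<forall>i\<in>{1..k}. induced G (W i) \<in> P i" using QP by simp
  moreover have "disjoint_family_on W {1..k}" using W_disj unfolding disjoint_family_on_def by blast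
  ultimately have part: "G \<in> Part \<tau> k P"
    using finG W_cover unfolding Part_def mem_Collect_eq vG by (intro conjI exI[of _ W])
  have "(\<Sum>r<?l. real (card (sym_diff (rels A ! r) (rels G ! r))))
      \<le> (\<Sum>r<?l. (\<Sum>i\<in>{1..k}. real (card (sym_diff (rels (induced A (U i)) ! r) (rels (B i) ! r))))
          + 2 * \<zeta> * ?n ^ 2)"
  proof (rule sum_mono)
    fix r assume "r \<in> {..<?l}"
    then have r: "r < ?l" by simp
    let ?T = "{t. length t = 2 \<and> set t \<subseteq> verts A \<and> set t \<inter> Z \<noteq> {}}"
    let ?d = "\<lambda>i. sym_diff (rels (induced A (U i)) ! r) (rels (B i) ! r)"
    have sub: "sym_diff (rels A ! r) (rels G ! r) \<subseteq> (\<Union>i\<in>{1..k}. ?d i) \<union> ?T"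
    proof
      fix t assume t: "t \<in> sym_diff (rels A ! r) (rels G ! r)"
      then have t2: "length t = 2" "set t \<subseteq> verts A" using tA[OF r] tG[OF r] by auto
      show "t \<in> (\<Union>i\<in>{1..k}. ?d i) \<union> ?T"
      proof (cases "set t \<inter> Z = {}")
        case True
        have "\<exists>i\<in>{1..k}. set t \<subseteq> W i"
        proof (rule ccontr)
          assume "\<not> ?thesis"
          then show False using t tQ[OF r] unfolding rG[OF r] by blast
        qed
        then obtain i where i: "i \<in> {1..k}" "set t \<subseteq> W i" by blast
        have tV: "set t \<subseteq> V i" using i(2) W_V True by blast
        have "t \<in> rels G ! r \<longleftrightarrow> t \<in> rels (Q i) ! r" using G_in[OF r i t2(1)] .
        also have "\<dots> \<longleftrightarrow> t \<in> rels (induced (Q i) (V i)) ! r"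
          using tV r lQ[OF i(1)] by simp
        also have "\<dots> \<longleftrightarrow> t \<in> rels (B i) ! r"
          unfolding QB using tV r lB[OF i(1)] by simp
        finally have "t \<in> rels G ! r \<longleftrightarrow> t \<in> rels (B i) ! r" .
        moreover have "t \<in> rels A ! r \<longleftrightarrow> t \<in> rels (induced A (U i)) ! r"
          using tV VU r lA by auto
        ultimately have "t \<in> ?d i" using t by blast
        then show ?thesis using i(1) by blast
      qed (use t2 in auto)
    qed
    have fd: "finite (?d i)" if i: "i \<in> {1..k}" for i
    proof (rule finite_subset)
      have ri: "r < length (rels A)" using r lA by simp
      show "?d i \<subseteq> {t. set t \<subseteq> verts A \<and> length t = 2}"
      proof
        fix t assume "t \<in> ?d i"
        then have "t \<in> rels A ! r \<or> t \<in> rels (B i) ! r"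
          unfolding rels_induced_nth[OF ri] by blast
        then show "t \<in> {t. set t \<subseteq> verts A \<and> length t = 2}"
        proof
          assume "t \<in> rels (B i) ! r"
          from finite_structure_tuple[OF finB[OF i] r this] show ?thesis
            using B(2)[OF i] U[OF i] ar[OF r] by auto
        qed (use tA[OF r] in auto)
      qed
      show "finite {t. set t \<subseteq> verts A \<and> length t = 2}" using finA by (rule finite_lists_length_eq)
    qed
    have fT: "finite ?T"
      using finite_lists_length_eq[OF finA, of 2] by (rule rev_finite_subset) auto
    have "card (sym_diff (rels A ! r) (rels G ! r)) \<le> card ((\<Union>i\<in>{1..k}. ?d i) \<union> ?T)"
      using fd fT by (intro card_mono[OF _ sub]) simp
    also have "\<dots> \<le> card (\<Union>i\<in>{1..k}. ?d i) + card ?T" by (rule card_Un_le)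
    also have "\<dots> \<le> (\<Sum>i\<in>{1..k}. card (?d i)) + 2 * card Z * card (verts A)"
      using card_pairs_meeting[OF finA, of Z] by (intro add_mono card_UN_le) (auto simp: Z)
    finally have "real (card (sym_diff (rels A ! r) (rels G ! r)))
        \<le> real ((\<Sum>i\<in>{1..k}. card (?d i)) + 2 * card Z * card (verts A))"
      by (rule of_nat_mono)
    also have "\<dots> = (\<Sum>i\<in>{1..k}. real (card (?d i))) + 2 * real (card Z) * ?n" by simp
    also have "\<dots> \<le> (\<Sum>i\<in>{1..k}. real (card (?d i))) + 2 * (\<zeta> * ?n) * ?n"
      using z(1) by (intro add_left_mono mult_right_mono mult_left_mono) auto
    finally show "real (card (sym_diff (rels A ! r) (rels G ! r)))
        \<le> (\<Sum>i\<in>{1..k}. real (card (?d i))) + 2 * \<zeta> * ?n ^ 2"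
      by (simp add: power2_eq_square mult.assoc)
  qed
  also have "\<dots> = (\<Sum>i\<in>{1..k}. \<Sum>r<?l. real (card (sym_diff (rels (induced A (U i)) ! r) (rels (B i) ! r))))
      + real ?l * (2 * \<zeta> * ?n ^ 2)"
    by (simp add: sum.distrib sum.swap[of _ "{..<?l}"])
  also have "\<dots> \<le> (\<Sum>i\<in>{1..k}. \<delta> * (real ?l * ?n ^ 2)) + real ?l * (2 * \<zeta> * ?n ^ 2)"
  proof (intro add_right_mono sum_mono)
    fix i assume i: "i \<in> {1..k}"
    have "(\<Sum>r<?l. real (card (sym_diff (rels (induced A (U i)) ! r) (rels (B i) ! r))))
        \<le> \<delta> * (real ?l * real (card (verts (induced A (U i)))) ^ 2)"
      using \<delta>(2)[OF i] B(2)[OF i] binary_struct_dist_le_iff[OF bin finite_structure_induced[OF A U[OF i]] finB[OF i] _ \<delta>(1)]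
      by simp
    also have "\<dots> \<le> \<delta> * (real ?l * ?n ^ 2)"
      using \<delta>(1) card_mono[OF finA U[OF i]] by (intro mult_left_mono power_mono) auto
    finally show "(\<Sum>r<?l. real (card (sym_diff (rels (induced A (U i)) ! r) (rels (B i) ! r))))
        \<le> \<delta> * (real ?l * ?n ^ 2)" .
  qed
  also have "\<dots> = (real k * \<delta> + 2 * \<zeta>) * (real ?l * ?n ^ 2)" by (simp add: algebra_simps)
  finally have "struct_dist \<tau> A G \<le> real k * \<delta> + 2 * \<zeta>"
    using binary_struct_dist_le_iff[OF bin A finG vG, of "real k * \<delta> + 2 * \<zeta>"] \<delta>(1) z(2) by simp
  then show ?thesis using part vG by blast
qed

lemma induced_empty_mem:
  assumes bin: "\<forall>a\<in>set \<tau>. a = 2" and "finite_structure \<tau> A" "is_property \<tau> P" "hereditary P" "P \<noteq> {}"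
  shows "induced A {} \<in> P"
proof -
  obtain B where B: "B \<in> P" using assms by auto
  have fB: "finite_structure \<tau> B" using is_propertyD(1)[OF assms(3) B] .
  have no: "rels (induced C {}) ! r = {}" if C: "finite_structure \<tau> C" and r: "r < length \<tau>" for C :: "nat rstruct" and r
  proof -
    have "r < length (rels C)" using C r by (simp add: finite_structure_def)
    moreover have "[] \<notin> rels C ! r"
      using finite_structure_tuple(1)[OF C r] bin nth_mem[OF r] by fastforce
    ultimately show ?thesis by auto
  qed
  have "induced A {} = induced B {}"
    by (rule rstruct_eqI) (use assms(2) fB no[OF assms(2)] no[OF fB] in \<open>auto simp: finite_structure_def\<close>)
  moreover have "induced B {} \<in> P" using assms(4) B by (auto simp: hereditary_def)
  ultimately show ?thesis by simp
qed

lemma struct_dist_self: "struct_dist \<tau> A A = 0"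
  by (simp add: struct_dist_def)

text \<open>
  Containers that are merely known to be small are replaced by the empty set, which uncovers at
  most \<open>\<epsilon> n / 8\<close> further vertices in total. If the conclusion failed, gluing would then apply with
  \<open>\<zeta> = \<epsilon> / 4\<close> and produce a member at distance at most \<open>\<epsilon> / 8 + \<epsilon> / 2\<close>.
\<close>

lemma uncovered_large:
  assumes bin: "\<forall>a\<in>set \<tau>. a = 2" and A: "finite_structure \<tau> A" and k: "1 \<le> k"
    and property: "\<And>i. i \<in> {1..k} \<Longrightarrow> is_property \<tau> (P i)" "\<And>i. i \<in> {1..k} \<Longrightarrow> P i \<noteq> {}"
    and her: "\<And>i. i \<in> {1..k} \<Longrightarrow> hereditary (P i)" and ext: "extendable (P 1)"
    and \<epsilon>: "0 < \<epsilon>" "far \<tau> (Part \<tau> k P) \<epsilon> A"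
    and C: "\<And>i. i \<in> {1..k} \<Longrightarrow> C i \<subseteq> verts A"
      "\<And>i. i \<in> {1..k} \<Longrightarrow> real (card (C i)) \<le> \<epsilon> / (8 * real k) * real (card (verts A)) \<or>
         \<not> far \<tau> (P i) (\<epsilon> / (8 * real k)) (induced A (C i))"
  shows "\<epsilon> / 8 * real (card (verts A)) < real (card (verts A - (\<Union>i\<in>{1..k}. C i)))"
proof (rule ccontr)
  let ?n = "real (card (verts A))" and ?\<delta> = "\<epsilon> / (8 * real k)"
  assume "\<not> ?thesis"
  then have small: "real (card (verts A - (\<Union>i\<in>{1..k}. C i))) \<le> \<epsilon> / 8 * ?n" by simp
  have finA: "finite (verts A)" using A by (simp add: finite_structure_def)
  define close where "close i \<longleftrightarrow> \<not> far \<tau> (P i) ?\<delta> (induced A (C i))" for i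
  define U where "U i = (if close i then C i else {})" for i
  have \<delta>: "0 \<le> ?\<delta>" using \<epsilon>(1) by simp
  have "\<exists>B. B \<in> P i \<and> verts B = U i \<and> struct_dist \<tau> (induced A (U i)) B \<le> ?\<delta>" if i: "i \<in> {1..k}" for i
  proof (cases "close i")
    case True
    then show ?thesis by (auto simp: close_def far_def U_def not_less)
  next
    case False
    have "induced A {} \<in> P i" using induced_empty_mem[OF bin A property(1)[OF i] her[OF i] property(2)[OF i]] .
    then show ?thesis using False \<delta> by (intro exI[of _ "induced A {}"]) (simp add: U_def struct_dist_self)
  qed
  then obtain B where B: "\<And>i. i \<in> {1..k} \<Longrightarrow> B i \<in> P i" "\<And>i. i \<in> {1..k} \<Longrightarrow> verts (B i) = U i"
      "\<And>i. i \<in> {1..k} \<Longrightarrow> struct_dist \<tau> (induced A (U i)) (B i) \<le> ?\<delta>"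
    by metis
  have UA: "U i \<subseteq> verts A" if "i \<in> {1..k}" for i using C(1)[OF that] by (simp add: U_def)
  let ?Z = "verts A - (\<Union>i\<in>{1..k}. U i)"
  have fC: "finite (C i)" if "i \<in> {1..k}" for i using C(1)[OF that] finA by (rule finite_subset)
  have "card ?Z \<le> card ((verts A - (\<Union>i\<in>{1..k}. C i)) \<union> (\<Union>i\<in>{1..k}. C i - U i))"
    using finA fC by (intro card_mono) auto
  also have "\<dots> \<le> card (verts A - (\<Union>i\<in>{1..k}. C i)) + (\<Sum>i\<in>{1..k}. card (C i - U i))"
    by (rule order_trans[OF card_Un_le]) (intro add_left_mono card_UN_le, simp)
  finally have "real (card ?Z) \<le> real (card (verts A - (\<Union>i\<in>{1..k}. C i))) + (\<Sum>i\<in>{1..k}. real (card (C i - U i)))"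
    by (metis of_nat_add of_nat_mono of_nat_sum)
  also have "\<dots> \<le> \<epsilon> / 8 * ?n + (\<Sum>i\<in>{1..k}. ?\<delta> * ?n)"
  proof (intro add_mono small sum_mono)
    fix i assume i: "i \<in> {1..k}"
    show "real (card (C i - U i)) \<le> ?\<delta> * ?n"
    proof (cases "close i")
      case True
      have "0 \<le> ?\<delta> * ?n" using \<delta> by (rule mult_nonneg_nonneg) simp
      then show ?thesis using True by (simp add: U_def)
    next
      case False
      then show ?thesis using C(2)[OF i] by (simp add: U_def close_def)
    qed
  qed
  also have "\<dots> = \<epsilon> / 4 * ?n" using k by (simp add: field_simps)
  finally have Z: "real (card ?Z) \<le> \<epsilon> / 4 * ?n" .
  obtain G where "G \<in> Part \<tau> k P" "verts G = verts A" "struct_dist \<tau> A G \<le> real k * ?\<delta> + 2 * (\<epsilon> / 4)"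
    using glue_parts[OF bin A k property(1) her ext UA B(1,2) \<delta> B(3) refl Z] \<epsilon>(1) by auto
  moreover have "real k * ?\<delta> + 2 * (\<epsilon> / 4) < \<epsilon>" using k \<epsilon>(1) by (simp add: field_simps)
  ultimately show False using \<epsilon>(2) by (auto simp: far_def)
qed

text \<open>
  Gluing with empty sets, so that every vertex is uncovered, already gives a member at distance at
  most two. So for such \<open>\<epsilon>\<close> the empty sample suffices, as it must if the sample size is to obey a
  bound that tends to zero when \<open>\<epsilon>\<close> grows.
\<close>

lemma not_far_if_ge_2:
  assumes bin: "\<forall>a\<in>set \<tau>. a = 2" and A: "finite_structure \<tau> A" and k: "1 \<le> k"
    and property: "\<And>i. i \<in> {1..k} \<Longrightarrow> is_property \<tau> (P i)" "\<And>i. i \<in> {1..k} \<Longrightarrow> P i \<noteq> {}"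
    and her: "\<And>i. i \<in> {1..k} \<Longrightarrow> hereditary (P i)" and ext: "extendable (P 1)"
    and "2 \<le> \<epsilon>"
  shows "\<not> far \<tau> (Part \<tau> k P) \<epsilon> A"
proof -
  have "\<exists>G\<in>Part \<tau> k P. verts G = verts A \<and> struct_dist \<tau> A G \<le> real k * 0 + 2 * 1"
    by (rule glue_parts[where P = P, OF bin A k property(1) her ext, where U = "\<lambda>_. {}" and B = "\<lambda>_. induced A {}"])
      (use induced_empty_mem[OF bin A] property her in \<open>auto simp: struct_dist_self\<close>)
  then show ?thesis using \<open>2 \<le> \<epsilon>\<close> unfolding far_def by force
qed

section \<open>From one-sided testers to containers\<close>

lemma pmf_verdict_False:
  assumes "finite (verts A)" "s \<le> card (verts A)"
  shows "pmf (verdict P s R A) False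
    = real (card {S. S \<subseteq> verts A \<and> card S = s \<and> induced A S \<in> R}) / real (card (verts A) choose s)"
proof -
  let ?D = "{S. S \<subseteq> verts A \<and> card S = s}"
  have card: "card ?D = card (verts A) choose s" using assms(1) by (rule n_subsets)
  then have ne: "?D \<noteq> {}" using assms(2) by (metis binomial_eq_0_iff card.empty not_le)
  have "pmf (verdict P s R A) False = measure (pmf_of_set ?D) ((\<lambda>S. induced A S \<notin> R) -` {False})"
    using assms(2) by (simp add: verdict_def pmf_map)
  also have "\<dots> = real (card (?D \<inter> (\<lambda>S. induced A S \<notin> R) -` {False})) / real (card ?D)"
    using ne assms(1) by (intro measure_pmf_of_set) auto
  also have "?D \<inter> (\<lambda>S. induced A S \<notin> R) -` {False} = {S. S \<subseteq> verts A \<and> card S = s \<and> induced A S \<in> R}"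
    by auto
  finally show ?thesis unfolding card .
qed

lemma one_sided_sample_not_rejected:
  assumes tester: "one_sided_tester \<tau> P s R" and "is_property \<tau> P" "0 < \<delta>"
    and B: "B \<in> P" "T \<subseteq> verts B" "card T = s \<delta>"
  shows "induced B T \<notin> R \<delta>"
proof
  assume rej: "induced B T \<in> R \<delta>"
  have fin: "finite (verts B)" using is_propertyD(1)[OF assms(2) B(1)] by (simp add: finite_structure_def)
  have le: "s \<delta> \<le> card (verts B)" using card_mono[OF fin B(2)] B(3) by simp
  have "pmf (verdict P (s \<delta>) (R \<delta>) B) True = 1"
    using tester assms(3) B(1) by (simp add: one_sided_tester_def)
  then have "pmf (verdict P (s \<delta>) (R \<delta>) B) False = 0" by (simp add: pmf_False_conv_True)
  then have "card {S. S \<subseteq> verts B \<and> card S = s \<delta> \<and> induced B S \<in> R \<delta>} = 0"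
    using le by (simp add: pmf_verdict_False[OF fin le] del: card_eq_0_iff)
  moreover have "finite {S. S \<subseteq> verts B \<and> card S = s \<delta> \<and> induced B S \<in> R \<delta>}"
    using fin by (auto intro: finite_subset[OF _ finite_Pow_iff[THEN iffD2, OF fin]])
  ultimately have "{S. S \<subseteq> verts B \<and> card S = s \<delta> \<and> induced B S \<in> R \<delta>} = {}" by simp
  then show False using rej B by blast
qed

text \<open>
  This is soundness of the tester, read as a statement about the hypergraph of rejected sets. The
  test is applied to the structure induced on \<open>W\<close>, whose samples are also samples of \<open>A\<close>.
\<close>

lemma far_imp_two_thirds_full:
  assumes tester: "one_sided_tester \<tau> P s R" and "0 < \<delta>"
    and A: "finite_structure \<tau> A" and W: "W \<subseteq> verts A" "s \<delta> \<le> card W"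
    and far: "far \<tau> P \<delta> (induced A W)"
  shows "two_thirds_full {e. e \<subseteq> verts A \<and> card e = s \<delta> \<and> induced A e \<in> R \<delta>} (s \<delta>) W"
proof -
  have fW: "finite W" using W A by (auto simp: finite_structure_def dest: finite_subset)
  have "2 / 3 \<le> pmf (verdict P (s \<delta>) (R \<delta>) (induced A W)) False"
    using tester assms(2) far finite_structure_induced[OF A W(1)] unfolding one_sided_tester_def by blast
  also have "\<dots> = real (card {S. S \<subseteq> W \<and> card S = s \<delta> \<and> induced (induced A W) S \<in> R \<delta>})
      / real (card W choose s \<delta>)"
    using pmf_verdict_False[of "induced A W"] fW W(2) by simp
  also have "{S. S \<subseteq> W \<and> card S = s \<delta> \<and> induced (induced A W) S \<in> R \<delta>}
      = {e \<in> {e. e \<subseteq> verts A \<and> card e = s \<delta> \<and> induced A e \<in> R \<delta>}. e \<subseteq> W}"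
    using W(1) by (auto simp: induced_induced)
  finally show ?thesis
    using W(2) by (simp add: two_thirds_full_def pos_le_divide_eq zero_less_binomial)
qed

text \<open>
  A final container is small, or has fewer than \<open>2 S\<close> vertices and is again small because \<open>n\<close> is
  large, or has too few rejected subsets to induce a structure that is far from \<open>P\<close>.
\<close>

lemma property_containers:
  assumes tester: "one_sided_tester \<tau> P s R" and P: "is_property \<tau> P" and \<delta>: "0 < \<delta>"
    and A: "finite_structure \<tau> A" and S: "s \<delta> \<le> S" "1 \<le> S"
    and r: "(1 - 1 / (4 * real S)) ^ r \<le> \<gamma>" and n: "2 * real S \<le> \<gamma> * real (card (verts A))"
  shows "\<exists>fp c. fingerprints {I. I \<subseteq> verts A \<and> induced A I \<in> P} (S * r) fp c \<and>
           (\<forall>I. I \<subseteq> verts A \<and> induced A I \<in> P \<longrightarrow> I \<subseteq> c I) \<and>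
           (\<forall>J. c J \<subseteq> verts A \<and> (real (card (c J)) \<le> \<gamma> * real (card (verts A)) \<or>
              \<not> far \<tau> P \<delta> (induced A (c J))))"
proof -
  define H where "H = {e. e \<subseteq> verts A \<and> card e = s \<delta> \<and> induced A e \<in> R \<delta>}"
  have fV: "finite (verts A)" using A by (simp add: finite_structure_def)
  have "\<forall>e\<in>H. card e = s \<delta>" by (simp add: H_def)
  from containers_exist[OF fV this S, of r] obtain fp c where
    fpc: "fingerprints (independent_sets H \<inter> Pow (verts A)) (S * r) fp c \<and>
      (\<forall>I\<in>independent_sets H \<inter> Pow (verts A). I \<subseteq> c I) \<and>
      (\<forall>J. c J \<subseteq> verts A \<and> (card (c J) < 2 * S \<or> \<not> two_thirds_full H (s \<delta>) (c J) \<or>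
        real (card (c J)) \<le> (1 - 1 / (4 * real S)) ^ r * real (card (verts A))))"
    by (elim exE) (rule that)
  note fp = fpc[THEN conjunct1]
    and sup = fpc[THEN conjunct2, THEN conjunct1, THEN bspec]
    and c = fpc[THEN conjunct2, THEN conjunct2, THEN spec, THEN conjunct1]
      fpc[THEN conjunct2, THEN conjunct2, THEN spec, THEN conjunct2]
  have ind: "I \<in> independent_sets H \<inter> Pow (verts A)" if "I \<subseteq> verts A" "induced A I \<in> P" for I
  proof -
    have "\<not> e \<subseteq> I" if e: "e \<in> H" for e
    proof
      assume "e \<subseteq> I"
      then have "induced (induced A I) e \<notin> R \<delta>"
        using one_sided_sample_not_rejected[OF tester P \<delta> \<open>induced A I \<in> P\<close>, of e] e by (simp add: H_def)
      then show False using e \<open>e \<subseteq> I\<close> by (simp add: H_def induced_induced)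
    qed
    then show ?thesis using that(1) by (simp add: independent_sets_def)
  qed
  have "fingerprints {I. I \<subseteq> verts A \<and> induced A I \<in> P} (S * r) fp c"
    using fp ind unfolding fingerprints_def by blast
  moreover have "real (card (c J)) \<le> \<gamma> * real (card (verts A)) \<or> \<not> far \<tau> P \<delta> (induced A (c J))" for J
  proof (rule disjCI)
    assume "\<not> \<not> far \<tau> P \<delta> (induced A (c J))"
    then have far: "far \<tau> P \<delta> (induced A (c J))" by simp
    show "real (card (c J)) \<le> \<gamma> * real (card (verts A))"
    proof (cases "card (c J) < 2 * S")
      case True
      then show ?thesis using n by linarith
    next
      case False
      then have "s \<delta> \<le> card (c J)" using S by simp
      then have "two_thirds_full H (s \<delta>) (c J)"
        unfolding H_def using far_imp_two_thirds_full[OF tester \<delta> A c(1) _ far] by blast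
      then have "real (card (c J)) \<le> (1 - 1 / (4 * real S)) ^ r * real (card (verts A))"
        using c(2)[of J] False by blast
      also have "\<dots> \<le> \<gamma> * real (card (verts A))" using r by (rule mult_right_mono) simp
      finally show ?thesis .
    qed
  qed
  moreover have "I \<subseteq> c I" if "I \<subseteq> verts A \<and> induced A I \<in> P" for I
    using sup[OF ind] that by blast
  ultimately show ?thesis using c(1) by (intro exI[of _ fp] exI[of _ c] conjI allI impI)
qed

text \<open>
  The only sample is the empty one. It induces a member of \<open>P\<close>, so a one-sided tester accepts it
  and hence every input.
\<close>

lemma nothing_far_if_no_samples:
  assumes tester: "one_sided_tester \<tau> P s R" and P: "is_property \<tau> P" and \<delta>: "0 < \<delta>" "s \<delta> = 0"
    and A: "finite_structure \<tau> A" and empty: "induced A {} \<in> P"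
  shows "\<not> far \<tau> P \<delta> A"
proof
  assume "far \<tau> P \<delta> A"
  then have far: "far \<tau> P \<delta> (induced A (verts A))" using induced_self[OF A] by simp
  have E: "{e. e \<subseteq> verts A \<and> card e = s \<delta> \<and> induced A e \<in> R \<delta>} = {}"
  proof -
    have "finite (verts A)" using A by (simp add: finite_structure_def)
    moreover have "induced A {} \<notin> R \<delta>"
      using one_sided_sample_not_rejected[OF tester P \<delta>(1) empty, of "{}"] \<delta>(2) by (simp add: induced_induced)
    ultimately show ?thesis unfolding \<delta>(2) by (auto dest: finite_subset)
  qed
  show False
    using far_imp_two_thirds_full[OF tester \<delta>(1) A subset_refl _ far] \<delta>(2) unfolding E by (simp add: two_thirds_full_def)
qed

section \<open>The sample size\<close>

text \<open>
  The number of rounds \<open>r\<close> makes \<open>(1 - 1 / (4 S))^r \<le> exp (- r / (4 S)) \<le> exp (- 4 L)\<close>, which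
  is at most \<open>x^(-4)\<close> for \<open>x = 2 + k / \<epsilon> + S\<close>, because \<open>ln x \<le> L\<close>, and hence at most \<open>\<epsilon> / (8 k)\<close>. Then \<open>k S r \<le> 17 k S\<^sup>2 L\<close>, and
  \<open>ln (s + 1) \<le> 18 L\<close> since \<open>s\<close> is polynomial in \<open>x\<close>. The exponent of the union bound is thus at
  most \<open>306 N\<close> with \<open>N = k S\<^sup>2 L\<^sup>2\<close>, against a gain of about \<open>\<epsilon> s / 8 \<ge> 512 N\<close>.
\<close>

lemma sample_size_suffices:
  fixes k S :: nat and \<epsilon> :: real
  assumes k: "1 \<le> k" and S: "1 \<le> S" and \<epsilon>: "0 < \<epsilon>" "\<epsilon> < 2"
  defines "L \<equiv> log 2 (2 + real k / \<epsilon> + real S)"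
  defines "M \<equiv> real k / \<epsilon> * real S ^ 2 * L ^ 2"
  defines "r \<equiv> nat \<lceil>16 * real S * L\<rceil>"
  defines "s \<equiv> nat \<lceil>4096 * M\<rceil>"
  shows "(1 - 1 / (4 * real S)) ^ r \<le> \<epsilon> / (8 * real k)"
    and "2 * real S \<le> \<epsilon> / (8 * real k) * real s"
    and "k * (S * r) \<le> s"
    and "(1 - \<epsilon> / 8) ^ (s - k * (S * r)) * real (s + 1) ^ (k * (S * r)) \<le> 1 / 3"
    and "real s \<le> 4098 * M"
proof -
  define x where "x = 2 + real k / \<epsilon> + real S"
  have k\<epsilon>: "1 / 2 \<le> real k / \<epsilon>" using k \<epsilon> by (simp add: field_simps)
  then have k\<epsilon>0: "0 \<le> real k / \<epsilon>" by linarith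
  have x: "2 \<le> x" "real k / \<epsilon> \<le> x" "real S \<le> x" 
    using k\<epsilon> unfolding x_def by linarith+
  have L: "L = log 2 x" by (simp add: L_def x_def)
  have L1: "1 \<le> L" unfolding L using x(1) by simp
  have ln2: "0 < ln (2::real)" "ln (2::real) \<le> 1" using ln_le_minus_one[of 2] by auto
  have lnx: "0 \<le> ln x" using x(1) by simp
  have lnL: "ln x \<le> L"
  proof -
    have "ln x = L * ln 2" unfolding L log_def by simp
    also have "\<dots> \<le> L * 1" using L1 ln2 by (intro mult_left_mono) auto
    finally show ?thesis by simp
  qed
  have Lx: "L \<le> x"
  proof -
    have "1 / 2 \<le> ln (2::real)" using ln_one_minus_pos_upper_bound[of "1 / 2"] by (simp add: ln_div)
    then have "x * (1 / 2) \<le> x * ln 2" using x(1) by (intro mult_left_mono) auto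
    moreover have "ln x \<le> x / 2"
      using ln_le_minus_one[of "x / 2"] x(1) ln2 by (simp add: ln_div)
    ultimately have "ln x \<le> x * ln 2" by linarith
    then show ?thesis unfolding L log_def using ln2 by (simp add: pos_divide_le_eq)
  qed
  have r: "16 * real S * L \<le> real r" "real r \<le> 17 * real S * L"
  proof -
    have "1 \<le> real S * L" using S L1 mult_mono[of 1 "real S" 1 L] by simp
    moreover have "real r = of_int \<lceil>16 * real S * L\<rceil>" unfolding r_def using S L1 by simp
    ultimately show "16 * real S * L \<le> real r" "real r \<le> 17 * real S * L" by linarith+
  qed
  define N where "N = real k * real S ^ 2 * L ^ 2"
  have N1: "1 \<le> N"
    unfolding N_def using k S L1 by (intro mult_ge1_I) (auto simp: one_le_power)
  have MN: "M = N / \<epsilon>" by (simp add: M_def N_def)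
  have M1: "1 \<le> 2 * M" using N1 \<epsilon> unfolding MN by (simp add: field_simps)
  have s: "4096 * M \<le> real s" "real s \<le> 4096 * M + 1"
  proof -
    have "real s = of_int \<lceil>4096 * M\<rceil>" unfolding s_def using M1 by simp
    then show "4096 * M \<le> real s" "real s \<le> 4096 * M + 1" by linarith+
  qed
  show "real s \<le> 4098 * M" using s M1 by simp
  have \<epsilon>s: "4096 * N \<le> \<epsilon> * real s"
    using mult_left_mono[OF s(1), of \<epsilon>] \<epsilon> by (simp add: MN)
  define q where "q = real k * (real S * real r)"
  have q: "q \<le> 17 * (real k * real S ^ 2 * L)"
  proof -
    have "q \<le> real k * (real S * (17 * real S * L))"
      unfolding q_def using r by (intro mult_left_mono) auto
    then show ?thesis by (simp add: power2_eq_square mult_ac)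
  qed
  have qL: "q * L \<le> 17 * N"
    using mult_right_mono[OF q, of L] L1 by (simp add: N_def power2_eq_square mult_ac)
  have q0: "0 \<le> q" by (simp add: q_def)
  have qN: "q \<le> 17 * N" using qL mult_left_mono[OF L1 q0] by simp
  have qs: "q \<le> real s"
  proof -
    have "\<epsilon> * real s \<le> 2 * real s" using \<epsilon> by (intro mult_right_mono) auto
    then show ?thesis using \<epsilon>s qN N1 by linarith
  qed
  have qnat: "real (k * (S * r)) = q" by (simp add: q_def)
  show krs: "k * (S * r) \<le> s" using qs unfolding qnat[symmetric] of_nat_le_iff .
  show "(1 - 1 / (4 * real S)) ^ r \<le> \<epsilon> / (8 * real k)"
  proof -
    have "(1 - 1 / (4 * real S)) ^ r \<le> exp (- (1 / (4 * real S))) ^ r"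
      using S exp_ge_add_one_self[of "- (1 / (4 * real S))"] by (intro power_mono) (auto simp: field_simps)
    also have "\<dots> = exp (- (real r / (4 * real S)))" by (simp add: exp_of_nat_mult[symmetric])
    also have "\<dots> \<le> exp (- (4 * ln x))"
    proof -
      have "4 * L \<le> real r / (4 * real S)" using r(1) S by (simp add: field_simps)
      then show ?thesis using lnL by simp
    qed
    also have "\<dots> = 1 / x ^ 4"
    proof -
      have "exp (4 * ln x) = x ^ 4" using x(1) exp_of_nat_mult[of 4 "ln x"] by simp
      then show ?thesis by (simp add: exp_minus inverse_eq_divide)
    qed
    also have "\<dots> \<le> 1 / (8 * (real k / \<epsilon>))"
    proof -
      have "8 * (real k / \<epsilon>) \<le> x ^ 3 * x"
        using x power_mono[of 2 x 3] k\<epsilon>0 by (intro mult_mono) (auto simp del: zero_le_divide_iff)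
      also have "\<dots> = x ^ 4" by (simp add: eval_nat_numeral)
      finally show ?thesis using k \<epsilon> x(1) by (intro divide_left_mono mult_pos_pos divide_pos_pos) auto
    qed
    finally show ?thesis by simp
  qed
  show "2 * real S \<le> \<epsilon> / (8 * real k) * real s"
  proof -
    have "16 * real k * real S \<le> 4096 * N"
    proof -
      have "real S * 1 \<le> real S ^ 2 * L ^ 2"
        using S self_le_power[of "real S" 2] one_le_power[OF L1, of 2] by (intro mult_mono) auto
      then have "real k * real S \<le> N" unfolding N_def by (simp add: mult.assoc mult_left_mono)
      then have "16 * (real k * real S) \<le> 4096 * N" using N1 by linarith
      then show ?thesis by (simp only: mult.assoc)
    qed
    then have "16 * real k * real S \<le> \<epsilon> * real s" using \<epsilon>s by linarith
    then show ?thesis using k by (simp add: field_simps)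
  qed
  have ln_s: "ln (real (s + 1)) \<le> 18 * L"
  proof -
    have "M \<le> x * x ^ 2 * x ^ 2"
      unfolding M_def using x k\<epsilon>0 L1 Lx by (intro mult_mono power_mono) (auto simp del: zero_le_divide_iff)
    then have Mx: "M \<le> x ^ 5" by (simp add: eval_nat_numeral mult_ac)
    have "(2::real) ^ 5 \<le> x ^ 5" using x(1) by (intro power_mono) auto
    then have "real (s + 1) \<le> 2 ^ 13 * x ^ 5" using s(2) Mx by simp
    also have "\<dots> \<le> x ^ 13 * x ^ 5" using x(1) by (intro mult_right_mono power_mono) auto
    also have "\<dots> = x ^ 18" by (simp flip: power_add)
    finally have "ln (real (s + 1)) \<le> ln (x ^ 18)" using x(1) by (subst ln_le_cancel_iff) auto
    also have "\<dots> = 18 * ln x" using x(1) by (simp add: ln_realpow)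
    finally show ?thesis using lnL by simp
  qed
  show "(1 - \<epsilon> / 8) ^ (s - k * (S * r)) * real (s + 1) ^ (k * (S * r)) \<le> 1 / 3"
  proof -
    have "(1 - \<epsilon> / 8) ^ (s - k * (S * r)) \<le> exp (- (\<epsilon> / 8)) ^ (s - k * (S * r))"
      using \<epsilon> exp_ge_add_one_self[of "- (\<epsilon> / 8)"] by (intro power_mono) auto
    also have "\<dots> = exp (- (\<epsilon> / 8 * (real s - q)))"
      using krs by (simp add: exp_of_nat_mult[symmetric] of_nat_diff q_def algebra_simps)
    finally have a: "(1 - \<epsilon> / 8) ^ (s - k * (S * r)) \<le> exp (- (\<epsilon> / 8 * (real s - q)))" .
    have "real (s + 1) ^ (k * (S * r)) = exp (q * ln (real (s + 1)))"
      unfolding qnat[symmetric] exp_of_nat_mult by simp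
    also have "\<dots> \<le> exp (q * (18 * L))"
      using ln_s q0 by (simp add: mult_left_mono)
    finally have b: "real (s + 1) ^ (k * (S * r)) \<le> exp (q * (18 * L))" .
    have "\<epsilon> * q \<le> 2 * q" using \<epsilon> q0 by (intro mult_right_mono) auto
    then have "q * (18 * L) - \<epsilon> / 8 * (real s - q) \<le> -2"
      using qL qN \<epsilon>s N1 by (simp add: algebra_simps)
    then have "exp (q * (18 * L) - \<epsilon> / 8 * (real s - q)) \<le> exp (-2)" by simp
    also have "\<dots> \<le> 1 / 3"
    proof -
      have "3 \<le> exp (2::real)" using exp_ge_add_one_self[of 2] by simp
      then have "inverse (exp (2::real)) \<le> inverse 3" by (intro le_imp_inverse_le) auto
      then show ?thesis by (simp add: exp_minus)
    qed
    finally have c: "exp (- (\<epsilon> / 8 * (real s - q))) * exp (q * (18 * L)) \<le> 1 / 3"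
      by (simp add: exp_add[symmetric])
    have "(1 - \<epsilon> / 8) ^ (s - k * (S * r)) * real (s + 1) ^ (k * (S * r))
        \<le> exp (- (\<epsilon> / 8 * (real s - q))) * exp (q * (18 * L))"
      using a b by (intro mult_mono) auto
    then show ?thesis using c by simp
  qed
qed

section \<open>Testing partition properties\<close>

text \<open>
  If a sample \<open>T\<close> lies in the partition property, its parts induce members of the \<open>P i\<close>, so \<open>T\<close> is
  one of the sets counted by \<open>card_covered_sets\<close> for \<open>\<beta> = \<epsilon> / 8\<close>.
\<close>

lemma Part_samples_rejected:
  assumes bin: "\<forall>a\<in>set \<tau>. a = 2" and A: "finite_structure \<tau> A" and k: "1 \<le> k"
    and property: "\<And>i. i \<in> {1..k} \<Longrightarrow> is_property \<tau> (P i)" "\<And>i. i \<in> {1..k} \<Longrightarrow> P i \<noteq> {}"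
    and her: "\<And>i. i \<in> {1..k} \<Longrightarrow> hereditary (P i)" and ext: "extendable (P 1)"
    and \<epsilon>: "0 < \<epsilon>" "\<epsilon> \<le> 8" "far \<tau> (Part \<tau> k P) \<epsilon> A"
    and tester: "\<And>i. i \<in> {1..k} \<Longrightarrow> one_sided_tester \<tau> (P i) (S_of i) (R i)"
    and S: "\<And>i. i \<in> {1..k} \<Longrightarrow> S_of i (\<epsilon> / (8 * real k)) \<le> S" "1 \<le> S"
    and n: "s \<le> card (verts A)"
    and num: "(1 - 1 / (4 * real S)) ^ r \<le> \<epsilon> / (8 * real k)"
      "2 * real S \<le> \<epsilon> / (8 * real k) * real s" "k * (S * r) \<le> s"
      "(1 - \<epsilon> / 8) ^ (s - k * (S * r)) * real (s + 1) ^ (k * (S * r)) \<le> 1 / 3"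
  shows "2 / 3 * real (card (verts A) choose s)
    \<le> real (card {T. T \<subseteq> verts A \<and> card T = s \<and> induced A T \<notin> Part \<tau> k P})"
proof -
  let ?\<delta> = "\<epsilon> / (8 * real k)" and ?V = "verts A" and ?N = "card (verts A) choose s"
  define \<I> where "\<I> i = {I. I \<subseteq> ?V \<and> induced A I \<in> P i}" for i
  have fV: "finite ?V" using A by (simp add: finite_structure_def)
  have \<delta>: "0 < ?\<delta>" using \<epsilon>(1) k by simp
  have "?\<delta> * real s \<le> ?\<delta> * real (card ?V)" using n \<delta> by (intro mult_left_mono) auto
  then have n': "2 * real S \<le> ?\<delta> * real (card ?V)" using num(2) by linarith
  have "\<forall>i\<in>{1..k}. \<exists>fp c. fingerprints (\<I> i) (S * r) fp c \<and>
           (\<forall>I. I \<subseteq> ?V \<and> induced A I \<in> P i \<longrightarrow> I \<subseteq> c I) \<and>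
           (\<forall>J. c J \<subseteq> ?V \<and> (real (card (c J)) \<le> ?\<delta> * real (card ?V) \<or>
              \<not> far \<tau> (P i) ?\<delta> (induced A (c J))))"
    unfolding \<I>_def using property_containers[OF tester property(1) \<delta> A S num(1) n'] by blast
  then obtain fp c where fc: "\<forall>i\<in>{1..k}. fingerprints (\<I> i) (S * r) (fp i) (c i) \<and>
           (\<forall>I. I \<subseteq> ?V \<and> induced A I \<in> P i \<longrightarrow> I \<subseteq> c i I) \<and>
           (\<forall>J. c i J \<subseteq> ?V \<and> (real (card (c i J)) \<le> ?\<delta> * real (card ?V) \<or>
              \<not> far \<tau> (P i) ?\<delta> (induced A (c i J))))"
    unfolding bchoice_iff by (elim exE) (rule that)
  note fc' = fc[THEN bspec]
  have uncov: "\<epsilon> / 8 * real (card ?V) \<le> real (card (?V - (\<Union>i\<in>{1..k}. c i (F i))))" for F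
  proof (rule less_imp_le)
    show "\<epsilon> / 8 * real (card ?V) < real (card (?V - (\<Union>i\<in>{1..k}. c i (F i))))"
    proof (rule uncovered_large[where P = P, OF bin A k property her ext \<epsilon>(1,3)])
      fix i assume i: "i \<in> {1..k}"
      show "c i (F i) \<subseteq> ?V" using fc'[OF i] by blast
      show "real (card (c i (F i))) \<le> ?\<delta> * real (card ?V) \<or> \<not> far \<tau> (P i) ?\<delta> (induced A (c i (F i)))"
        using fc'[OF i] by blast
    qed
  qed
  let ?all = "{T. T \<subseteq> ?V \<and> card T = s}"
  let ?bad = "{T. T \<subseteq> ?V \<and> card T = s \<and> (\<exists>I. T = (\<Union>i\<in>{1..k}. I i) \<and> (\<forall>i\<in>{1..k}. I i \<in> \<I> i))}"
  let ?rej = "{T. T \<subseteq> ?V \<and> card T = s \<and> induced A T \<notin> Part \<tau> k P}"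
  have "real (card ?bad) \<le> (1 - \<epsilon> / 8) ^ (s - card {1..k} * (S * r)) * real (s + 1) ^ (card {1..k} * (S * r)) * real ?N"
  proof (rule card_covered_sets[OF fV, where fp = fp and c = c])
    fix i I assume i: "i \<in> {1..k}"
    show "fingerprints (\<I> i) (S * r) (fp i) (c i)" using fc'[OF i] by blast
    show "I \<subseteq> c i I" if "I \<in> \<I> i" using fc'[OF i] that unfolding \<I>_def by blast
  qed (use uncov \<epsilon> num(3) in auto)
  also have "\<dots> \<le> 1 / 3 * real ?N" using num(4) by (intro mult_right_mono) auto
  finally have bad: "real (card ?bad) \<le> 1 / 3 * real ?N" .
  have "?all \<subseteq> ?rej \<union> ?bad"
  proof
    fix T assume T: "T \<in> ?all"
    show "T \<in> ?rej \<union> ?bad"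
    proof (cases "induced A T \<in> Part \<tau> k P")
      case True
      then obtain I where I: "(\<Union>i\<in>{1..k}. I i) = T" "\<forall>i\<in>{1..k}. induced (induced A T) (I i) \<in> P i"
        by (auto simp: Part_def)
      have "I i \<in> \<I> i" if i: "i \<in> {1..k}" for i
      proof -
        have "I i \<subseteq> T" using I(1) i by blast
        moreover have "induced (induced A T) (I i) \<in> P i" using I(2) i by blast
        ultimately show ?thesis using T by (auto simp: \<I>_def induced_induced)
      qed
      then show ?thesis using T I(1) by blast
    qed (use T in auto)
  qed
  then have "card ?all \<le> card (?rej \<union> ?bad)"
    by (rule card_mono[rotated]) (use fV in simp)
  also have "\<dots> \<le> card ?rej + card ?bad" by (rule card_Un_le)
  finally have "real ?N \<le> real (card ?rej) + real (card ?bad)"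
    using n_subsets[OF fV, of s] by simp
  then show ?thesis using bad by simp
qed

text \<open>
  The sample size is zero where nothing can be far, namely for \<open>\<epsilon> \<ge> 2\<close> and when no part needs a
  sample; a positive size would violate the bound for all sufficiently large \<open>\<epsilon>\<close> and whenever
  \<open>S\<close> vanishes. Elsewhere \<open>1 \<le> 2 M\<close>, so rounding up is absorbed by the constant.
\<close>

theorem theorem1p14:
  shows "\<exists>(C::real) (c::nat). \<forall>(\<tau>::signature) (k::nat) (P :: nat \<Rightarrow> family)
      (S_of :: nat \<Rightarrow> real \<Rightarrow> nat) (S :: real \<Rightarrow> nat).
    (\<forall>a\<in>set \<tau>. a = 2) \<and> k \<ge> 1 \<and>
    (\<forall>i\<in>{1..k}. is_property \<tau> (P i) \<and> P i \<noteq> {} \<and> hereditary (P i) \<and> extendable (P i) \<and>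
       one_sided_complexity \<tau> (P i) (S_of i)) \<and>
    (\<forall>\<delta>>0. S \<delta> = (MAX i\<in>{1..k}. S_of i \<delta>))
    \<longrightarrow> (\<exists>s. one_sided_complexity \<tau> (Part \<tau> k P) s \<and>
          (\<forall>\<epsilon>>0. real (s \<epsilon>) \<le>
             C * (real k / \<epsilon> * real (S (\<epsilon> / (8 * real k))) ^ 2) *
             log 2 (2 + real k / \<epsilon> + real (S (\<epsilon> / (8 * real k)))) ^ c))"
proof (rule exI[of _ 4098], rule exI[of _ 2], intro allI impI, elim conjE)
  fix \<tau> :: signature and k :: nat and P :: "nat \<Rightarrow> family"
    and S_of :: "nat \<Rightarrow> real \<Rightarrow> nat" and S :: "real \<Rightarrow> nat"
  assume bin: "\<forall>a\<in>set \<tau>. a = 2" and k: "1 \<le> k"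
    and hyps: "\<forall>i\<in>{1..k}. is_property \<tau> (P i) \<and> P i \<noteq> {} \<and> hereditary (P i) \<and> extendable (P i) \<and>
       one_sided_complexity \<tau> (P i) (S_of i)"
    and S_Max: "\<forall>\<delta>>0. S \<delta> = (MAX i\<in>{1..k}. S_of i \<delta>)"
  have one: "1 \<in> {1..k}" using k by simp
  note hyps' = hyps[THEN bspec]
  note property = hyps'[THEN conjunct1] hyps'[THEN conjunct2, THEN conjunct1]
    and her = hyps'[THEN conjunct2, THEN conjunct2, THEN conjunct1]
    and ext = hyps'[THEN conjunct2, THEN conjunct2, THEN conjunct2, THEN conjunct1]
    and compl = hyps'[THEN conjunct2, THEN conjunct2, THEN conjunct2, THEN conjunct2]
  have "\<forall>i\<in>{1..k}. \<exists>R. one_sided_tester \<tau> (P i) (S_of i) R"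
    using compl unfolding one_sided_complexity_def by simp
  then obtain R where "\<forall>i\<in>{1..k}. one_sided_tester \<tau> (P i) (S_of i) (R i)"
    unfolding bchoice_iff by (elim exE) (rule that)
  note tester = this[THEN bspec]
  have S_ge: "S_of i \<delta> \<le> S \<delta>" if "i \<in> {1..k}" "0 < \<delta>" for i \<delta>
    using S_Max that by simp
  have S_anti: "S \<delta>' \<le> S \<delta>" if "0 < \<delta>" "\<delta> \<le> \<delta>'" for \<delta> \<delta>'
  proof -
    have "S_of i \<delta>' \<le> S \<delta>" if i: "i \<in> {1..k}" for i
    proof -
      have "antimono_on {0<..} (S_of i)" using compl[OF i] by (simp add: one_sided_complexity_def)
      then have "S_of i \<delta>' \<le> S_of i \<delta>" using that \<open>0 < \<delta>\<close> \<open>\<delta> \<le> \<delta>'\<close> by (auto simp: monotone_on_def)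
      then show ?thesis using S_ge[OF i \<open>0 < \<delta>\<close>] by simp
    qed
    then show ?thesis using S_Max that one by (subst S_Max[rule_format]) auto
  qed
  define \<delta> where "\<delta> \<epsilon> = \<epsilon> / (8 * real k)" for \<epsilon>
  define L where "L \<epsilon> = log 2 (2 + real k / \<epsilon> + real (S (\<delta> \<epsilon>)))" for \<epsilon>
  define M where "M \<epsilon> = real k / \<epsilon> * real (S (\<delta> \<epsilon>)) ^ 2 * L \<epsilon> ^ 2" for \<epsilon>
  define s where "s \<epsilon> = (if 2 \<le> \<epsilon> \<or> S (\<delta> \<epsilon>) = 0 then 0 else nat \<lceil>4096 * M \<epsilon>\<rceil>)" for \<epsilon>
  define Q where "Q \<epsilon> = {A. finite_structure \<tau> A \<and> card (verts A) = s \<epsilon> \<and> A \<notin> Part \<tau> k P}" for \<epsilon>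
  have \<delta>_pos: "0 < \<delta> \<epsilon>" if "0 < \<epsilon>" for \<epsilon> using that k by (simp add: \<delta>_def)
  have L_pos: "0 \<le> L \<epsilon>" if "0 < \<epsilon>" for \<epsilon>
  proof -
    have "0 \<le> real k / \<epsilon>" using that by simp
    then have "1 \<le> 2 + real k / \<epsilon> + real (S (\<delta> \<epsilon>))" by linarith
    then show ?thesis unfolding L_def by simp
  qed
  have "antimono_on {0<..} s"
  proof (rule monotone_onI)
    fix \<epsilon> \<epsilon>' :: real assume e: "\<epsilon> \<in> {0<..}" "\<epsilon>' \<in> {0<..}" "\<epsilon> \<le> \<epsilon>'"
    have "\<delta> \<epsilon> \<le> \<delta> \<epsilon>'" using e(3) unfolding \<delta>_def by (intro divide_right_mono) auto
    then have Sle: "S (\<delta> \<epsilon>') \<le> S (\<delta> \<epsilon>)" using e \<delta>_pos by (intro S_anti) auto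
    have kle: "real k / \<epsilon>' \<le> real k / \<epsilon>" using e by (intro divide_left_mono) auto
    have k0: "0 \<le> real k / \<epsilon>'" using e by simp
    have "L \<epsilon>' \<le> L \<epsilon>" unfolding L_def using kle k0 Sle by simp
    then have "M \<epsilon>' \<le> M \<epsilon>"
      unfolding M_def using kle k0 Sle L_pos[of \<epsilon>'] e by (intro mult_mono power_mono) auto
    then have "nat \<lceil>4096 * M \<epsilon>'\<rceil> \<le> nat \<lceil>4096 * M \<epsilon>\<rceil>" by (intro nat_mono ceiling_mono) simp
    then show "s \<epsilon>' \<le> s \<epsilon>" using e(3) Sle unfolding s_def by auto
  qed
  moreover have "one_sided_tester \<tau> (Part \<tau> k P) s Q"
    unfolding one_sided_tester_def
  proof (intro allI impI conjI ballI)
    fix \<epsilon> :: real assume \<epsilon>: "0 < \<epsilon>"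
    show "is_property \<tau> (Q \<epsilon>)"
      unfolding Q_def by (intro is_property_sample_complement is_property_Part property)
    show "card (verts A) = s \<epsilon>" if "A \<in> Q \<epsilon>" for A using that by (simp add: Q_def)
    show "pmf (verdict (Part \<tau> k P) (s \<epsilon>) (Q \<epsilon>) A) True = 1" if A: "A \<in> Part \<tau> k P" for A
    proof (cases "card (verts A) < s \<epsilon>")
      case True
      then show ?thesis using A by (simp add: verdict_def)
    next
      case False
      have fV: "finite (verts A)" using A by (auto simp: Part_def finite_structure_def)
      have "hereditary (Part \<tau> k P)" using her by (rule hereditary_Part)
      then have "{T. T \<subseteq> verts A \<and> card T = s \<epsilon> \<and> induced A T \<in> Q \<epsilon>} = {}"
        using A by (auto simp: hereditary_def Q_def)
      then have "pmf (verdict (Part \<tau> k P) (s \<epsilon>) (Q \<epsilon>) A) False = 0"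
        using False fV by (subst pmf_verdict_False) auto
      then show ?thesis by (simp add: pmf_False_conv_True)
    qed
    fix A assume "finite_structure \<tau> A \<and> far \<tau> (Part \<tau> k P) \<epsilon> A"
    then have A: "finite_structure \<tau> A" and far: "far \<tau> (Part \<tau> k P) \<epsilon> A" by auto
    have fV: "finite (verts A)" using A by (simp add: finite_structure_def)
    have "\<epsilon> < 2" using not_far_if_ge_2[where P = P, OF bin A k property her ext[OF one], of \<epsilon>] far by force
    have "S (\<delta> \<epsilon>) \<noteq> 0"
    proof
      assume S0: "S (\<delta> \<epsilon>) = 0"
      have close: "\<not> far \<tau> (P i) (\<delta> \<epsilon>) A" if i: "i \<in> {1..k}" for i
        using nothing_far_if_no_samples[OF tester[OF i] property(1)[OF i] \<delta>_pos[OF \<epsilon>] _ A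
            induced_empty_mem[OF bin A property(1)[OF i] her[OF i] property(2)[OF i]]]
          S_ge[OF i \<delta>_pos[OF \<epsilon>]] S0 by simp
      have "\<epsilon> / 8 * real (card (verts A)) < real (card (verts A - (\<Union>i\<in>{1..k}. verts A)))"
        by (rule uncovered_large[where P = P, OF bin A k property her ext[OF one] \<epsilon> far])
          (use close induced_self[OF A] in \<open>simp_all add: \<delta>_def\<close>)
      also have "verts A - (\<Union>i\<in>{1..k}. verts A) = {}" using one by blast
      finally have "\<epsilon> / 8 * real (card (verts A)) < 0" by simp
      moreover have "0 \<le> \<epsilon> / 8 * real (card (verts A))" using \<epsilon> by simp
      ultimately show False by linarith
    qed
    then have S1: "1 \<le> S (\<delta> \<epsilon>)" by simp
    have s: "s \<epsilon> = nat \<lceil>4096 * M \<epsilon>\<rceil>" using \<open>\<epsilon> < 2\<close> \<open>S (\<delta> \<epsilon>) \<noteq> 0\<close> by (simp add: s_def)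
    show "2 / 3 \<le> pmf (verdict (Part \<tau> k P) (s \<epsilon>) (Q \<epsilon>) A) False"
    proof (cases "card (verts A) < s \<epsilon>")
      case True
      have "A \<notin> Part \<tau> k P" using far \<epsilon> struct_dist_self[of \<tau> A] by (auto simp: far_def)
      then show ?thesis using True by (simp add: verdict_def)
    next
      case False
      then have n: "s \<epsilon> \<le> card (verts A)" by simp
      note num = sample_size_suffices[OF k S1 \<epsilon> \<open>\<epsilon> < 2\<close>, folded L_def, folded M_def, folded s]
      have "\<epsilon> \<le> 8" using \<open>\<epsilon> < 2\<close> by simp
      from Part_samples_rejected[where P = P, OF bin A k property her ext[OF one] \<epsilon> this far tester
          S_ge[OF _ \<delta>_pos[OF \<epsilon>], unfolded \<delta>_def] S1[unfolded \<delta>_def] n num(1-4)[unfolded \<delta>_def]]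
      have "2 / 3 * real (card (verts A) choose s \<epsilon>)
          \<le> real (card {T. T \<subseteq> verts A \<and> card T = s \<epsilon> \<and> induced A T \<notin> Part \<tau> k P})" .
      also have "{T. T \<subseteq> verts A \<and> card T = s \<epsilon> \<and> induced A T \<notin> Part \<tau> k P}
          = {T. T \<subseteq> verts A \<and> card T = s \<epsilon> \<and> induced A T \<in> Q \<epsilon>}"
        using finite_structure_induced[OF A] by (auto simp: Q_def)
      finally show ?thesis
        using n by (simp add: pmf_verdict_False[OF fV n] pos_le_divide_eq zero_less_binomial)
    qed
  qed
  ultimately have "one_sided_complexity \<tau> (Part \<tau> k P) s" unfolding one_sided_complexity_def by blast
  moreover have "real (s \<epsilon>) \<le> 4098 * (real k / \<epsilon> * real (S (\<epsilon> / (8 * real k))) ^ 2) *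
      log 2 (2 + real k / \<epsilon> + real (S (\<epsilon> / (8 * real k)))) ^ 2" if \<epsilon>: "0 < \<epsilon>" for \<epsilon>
  proof -
    have "real (s \<epsilon>) \<le> 4098 * M \<epsilon>"
    proof (cases "2 \<le> \<epsilon> \<or> S (\<delta> \<epsilon>) = 0")
      case True
      then show ?thesis using \<epsilon> by (auto simp: s_def M_def)
    next
      case False
      then have S1: "1 \<le> S (\<delta> \<epsilon>)" and e2: "\<epsilon> < 2" by auto
      have s: "s \<epsilon> = nat \<lceil>4096 * M \<epsilon>\<rceil>" using False by (simp add: s_def)
      show ?thesis
        using sample_size_suffices(5)[OF k S1 \<epsilon> e2, folded L_def, folded M_def, folded s] .
    qed
    then show ?thesis by (simp add: M_def L_def \<delta>_def mult.assoc)
  qed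
  ultimately show "\<exists>s. one_sided_complexity \<tau> (Part \<tau> k P) s \<and>
          (\<forall>\<epsilon>>0. real (s \<epsilon>) \<le>
             4098 * (real k / \<epsilon> * real (S (\<epsilon> / (8 * real k))) ^ 2) *
             log 2 (2 + real k / \<epsilon> + real (S (\<epsilon> / (8 * real k)))) ^ 2)" by blast
qed

end
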